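(* Let $X=(X_1,\dots,X_n)$ be a random vector in $\mathbb{R}^n$ with independent components, let $d\in\{1,\dots,n\}$, and let $f=f(X)\in L^\infty(\mathbb{P})$ with $\mathbb{E}f=0$. For $t\ge 0$ put $$\eta_f(t)=\min\Big(\frac{t^{2/d}}{\lVert\mathfrak{h}^{(d)}f\rVert_{\mathrm{HS},\infty}^{2/d}},\ \min_{k=1,\dots,d-1}\frac{t^{2/k}}{\lVert\mathfrak{h}^{(k)}f\rVert_{\mathrm{HS},2}^{2/k}}\Big).$$ Then, for all $t\ge 0$, $$\mathbb{P}\{|f|\ge t\}\le e^2\exp\Big\{-\frac{\eta_f(t)}{41\,(de)^2}\Big\}.$$
   Context: Let $(\bar X_1,\dots,\bar X_n)$ be an independent copy of $X$. For Borel $f:\mathbb{R}^n\to\mathbb{R}$ with $f(X)\in L^\infty(\mathbb{P})$ write $f=f(X)$ and $T_if=f(X_1,\dots,X_{i-1},\bar X_i,X_{i+1},\dots,X_n)$. For indices $i_1,\dots,i_k$ put $$\mathfrak{h}_{i_1\dots i_k}f(X)=\frac1{2^k}\Big\lVert \prod_{s=1}^k(Id-T_{i_s})f(X)\Big\rVert_{i_1,\dots,i_k,\infty},$$ where $\lVert\cdot\rVert_{i_1,\dots,i_k,\infty}$ is the $L^\infty$-norm (essential supremum of the absolute value) with respect to $X_{i_1},\dots,X_{i_k},\bar X_{i_1},\dots,\bar X_{i_k}$, the other coordinates $X_j$ being kept fixed. The hypermatrix $\mathfrak{h}^{(k)}f$ has entries $\mathfrak{h}_{i_1\dots i_k}f(X)$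 if $i_1,\dots,i_k\in\{1,\dots,n\}$ are pairwise distinct and $0$ otherwise. $|\mathfrak{h}^{(k)}f|_{\mathrm{HS}}$ is its Euclidean norm in $\mathbb{R}^{n^k}$, and $\lVert \mathfrak{h}^{(k)}f\rVert_{\mathrm{HS},p}=(\mathbb{E}|\mathfrak{h}^{(k)}f|_{\mathrm{HS}}^p)^{1/p}$ for $0<p<\infty$, with the $L^\infty(\mathbb{P})$-norm for $p=\infty$. Here $e$ is Euler's number. A minimum over an empty set (case $d=1$) is $+\infty$; a quotient with zero denominator is read as $+\infty$ for $t>0$ and as $0$ for $t=0$; $\exp(-\infty)=0$. *)

theory Defs
  imports "HOL-Probability.Probability"
begin

text \<open>Powers, norms and minima are taken in \<^typ>\<open>ennreal\<close>. Its arithmetic realises the conventions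
  \<open>t / 0 = \<infinity>\<close> for \<open>t > 0\<close>, \<open>0 / 0 = 0\<close> and \<open>Inf {} = \<infinity>\<close>.\<close>

text \<open>Real powers; meant for positive exponents only, whence \<open>\<infinity>\<close> is mapped to \<open>\<infinity>\<close>.\<close>

definition epowr :: "ennreal \<Rightarrow> real \<Rightarrow> ennreal" where
  "epowr x p = (if x = \<infinity> then \<infinity> else ennreal (enn2real x powr p))"

definition exp_minus :: "ennreal \<Rightarrow> real" where
  "exp_minus x = (if x = \<infinity> then 0 else exp (- enn2real x))"

text \<open>A function of \<open>(X, \<bar>X)\<close>, with \<open>\<bar>X\<close> the independent copy, is represented by a function on
  pairs \<open>(x, \<bar>x)\<close>.\<close>

definition T_op ::
    "'n::finite \<Rightarrow> ((real^'n) \<times> (real^'n) \<Rightarrow> real) \<Rightarrow> (real^'n) \<times> (real^'n) \<Rightarrow> real" where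
  "T_op i F = (\<lambda>(x, xb). F (\<chi> j. if j = i then xb $ j else x $ j, xb))"

text \<open>The product over \<open>s\<close> of the operators \<open>Id - T\<^bsub>i\<^sub>s\<^esub>\<close> (composition), for the index list \<open>[i\<^sub>1, \<dots>, i\<^sub>k]\<close>.\<close>

definition diff_op ::
    "'n::finite list \<Rightarrow> ((real^'n) \<times> (real^'n) \<Rightarrow> real) \<Rightarrow> (real^'n) \<times> (real^'n) \<Rightarrow> real" where
  "diff_op is F = foldr (\<lambda>i G z. G z - T_op i G z) is F"

text \<open>The \<open>L\<^sup>\<infinity>\<close>-norm in the variables \<open>X\<^sub>i\<close>, \<open>\<bar>X\<^sub>i\<close> with \<open>i \<in> I\<close>, the coordinates \<open>x\<^sub>j\<close> with \<open>j \<notin> I\<close> being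
  fixed. The joint law of \<open>X\<close> and an independent copy is the product of the law of \<open>X\<close> with itself,
  so no copy has to live on \<open>M\<close>. It is meant for \<open>F\<close> that depend on \<open>\<bar>x\<close> only through the coordinates
  in \<open>I\<close>. As the components of \<open>X\<close> are independent, drawing \<open>y\<close> from the law of \<open>X\<close> and using only
  the coordinates of \<open>y\<close> in \<open>I\<close> amounts to integrating out \<open>X\<^sub>i\<close>, \<open>i \<in> I\<close>.\<close>

definition partial_Linf_norm ::
    "'a measure \<Rightarrow> ('a \<Rightarrow> real^'n) \<Rightarrow> 'n::finite set \<Rightarrow> ((real^'n) \<times> (real^'n) \<Rightarrow> real) \<Rightarrow> real^'n \<Rightarrow> ennreal"
  where
  "partial_Linf_norm M X I F x =
     esssup (distr M borel X \<Otimes>\<^sub>M distr M borel X)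
       (\<lambda>(y, yb). ennreal \<bar>F (\<chi> j. if j \<in> I then y $ j else x $ j, yb)\<bar>)"

definition h_diff ::
    "'a measure \<Rightarrow> ('a \<Rightarrow> real^'n) \<Rightarrow> (real^'n \<Rightarrow> real) \<Rightarrow> 'n::finite list \<Rightarrow> real^'n \<Rightarrow> ennreal" where
  "h_diff M X f is x =
     1 / 2 ^ length is * partial_Linf_norm M X (set is) (diff_op is (\<lambda>(x, xb). f x)) x"

definition h_entry ::
    "'a measure \<Rightarrow> ('a \<Rightarrow> real^'n) \<Rightarrow> (real^'n \<Rightarrow> real) \<Rightarrow> 'n::finite list \<Rightarrow> real^'n \<Rightarrow> ennreal" where
  "h_entry M X f is x = (if distinct is then h_diff M X f is x else 0)"

definition h_HS ::
    "'a measure \<Rightarrow> ('a \<Rightarrow> real^'n) \<Rightarrow> (real^'n::finite \<Rightarrow> real) \<Rightarrow> nat \<Rightarrow> real^'n \<Rightarrow> ennreal" where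
  "h_HS M X f k x = epowr (\<Sum>is | length is = k. (h_entry M X f is x)\<^sup>2) (1 / 2)"

definition h_HS_norm ::
    "'a measure \<Rightarrow> ('a \<Rightarrow> real^'n) \<Rightarrow> (real^'n::finite \<Rightarrow> real) \<Rightarrow> nat \<Rightarrow> ennreal \<Rightarrow> ennreal" where
  "h_HS_norm M X f k p =
     (if p = \<infinity> then esssup M (\<lambda>\<omega>. h_HS M X f k (X \<omega>))
      else epowr (\<integral>\<^sup>+ \<omega>. epowr (h_HS M X f k (X \<omega>)) (enn2real p) \<partial>M) (1 / enn2real p))"

definition eta ::
    "'a measure \<Rightarrow> ('a \<Rightarrow> real^'n) \<Rightarrow> (real^'n::finite \<Rightarrow> real) \<Rightarrow> nat \<Rightarrow> real \<Rightarrow> ennreal" where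
  "eta M X f d t =
     min (epowr (ennreal t) (2 / real d) / epowr (h_HS_norm M X f d \<infinity>) (2 / real d))
         (INF k\<in>{1..d - 1}. epowr (ennreal t) (2 / real k) / epowr (h_HS_norm M X f k 2) (2 / real k))"

end

theory Submission
  imports Defs "HOL-Real_Asymp.Real_Asymp"
begin

text \<open>Resampling the coordinates in a random set interpolates between \<open>X\<close> and an independent copy.
  Symmetrising each term of the interpolation in the resampled coordinate and applying Young's
  inequality gives, for even \<open>q\<close> and centred \<open>f\<close>, the bound
  \<open>E f\<^sup>q \<le> (4 (q - 1))\<^bsup>q/2\<^esup> E |hf|\<^sup>q\<close>. The increments of \<open>|h\<^bsup>(k)\<^esup>f|\<close> are dominated by the entries of
  \<open>h\<^bsup>(k+1)\<^esup>f\<close>, so the bound can be iterated, where at each level the mean of \<open>|h\<^bsup>(k)\<^esup>f|\<close> is at most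
  its \<open>L\<^sup>2\<close>-norm. Markov's inequality with \<open>q\<close> the largest even integer not above
  \<open>\<eta>\<^sub>f(t) / (41 (d e)\<^sup>2)\<close> gives the tail bound; rounding to even integers only costs the factor \<open>e\<^sup>2\<close>.\<close>

section \<open>Exchanging coordinates\<close>

text \<open>The hypermatrices depend only on the law of \<open>X\<close>, so the argument runs on
  \<open>real^'n\<close> under that law, with the copy as second component of the product measure.
  Independence enters in a single form: swapping any set of coordinates between the point and its
  copy preserves the product law. The entries are essential suprema, so increment bounds hold only
  almost everywhere on pairs; the same swaps carry the exceptional null sets from one mixed point to
  another.

  The iteration must not pick up a constant at each level. If R > 0 is a lower bound of eta and r =
  R^(-1/2), all norm bounds take the form t r^k, and the moment bound (2 t r^k)^q reproduces itself
  in passing from k + 1 to k: the mean and the fluctuation contribute (t r^k)^q each as soon as 16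
  (q - 1) r^2 <= 1, and convexity of the q-th power costs 2^q / 2. So 16 is the 4 of the moment
  inequality times the square of this 2. Asking for e^(-2) in place of 1 makes Markov's inequality
  give e^(-q).\<close>

definition mix :: "'n::finite set \<Rightarrow> real^'n \<Rightarrow> real^'n \<Rightarrow> real^'n" where
  "mix S x y = (\<chi> j. if j \<in> S then y $ j else x $ j)"

lemma mix_nth [simp]: "mix S x y $ j = (if j \<in> S then y $ j else x $ j)"
  by (simp add: mix_def)

lemma borel_measurable_vecI:
  fixes f :: "'a \<Rightarrow> real^'n"
  assumes "\<And>i. (\<lambda>x. f x $ i) \<in> borel_measurable M"
  shows "f \<in> borel_measurable M"
  by (rule borel_measurable_euclidean_space[THEN iffD2])
     (use assms in \<open>auto simp: Basis_vec_def inner_axis\<close>)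

lemma measurable_mix [measurable]:
  fixes f g :: "'a \<Rightarrow> real^'n"
  assumes f: "f \<in> borel_measurable M" and g: "g \<in> borel_measurable M"
  shows "(\<lambda>x. mix S (f x) (g x)) \<in> borel_measurable M"
proof (rule borel_measurable_vecI)
  fix i
  show "(\<lambda>x. mix S (f x) (g x) $ i) \<in> borel_measurable M"
    using measurable_compose[OF f borel_measurable_nth[of i]] measurable_compose[OF g borel_measurable_nth[of i]]
    by simp
qed

text \<open>Almost everywhere statements get nested below, and joining nested ones into one on a
  product requires the set where the inner one holds to be measurable.\<close>

lemma pred_AE:
  assumes "sigma_finite_measure P"
    and Q [measurable]: "Measurable.pred (N \<Otimes>\<^sub>M P) (\<lambda>(x, y). Q x y)"
  shows "Measurable.pred N (\<lambda>x. AE y in P. Q x y)"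
proof -
  interpret sigma_finite_measure P by fact
  have "(AE y in P. Q x y) \<longleftrightarrow> emeasure P {y \<in> space P. \<not> Q x y} = 0" if "x \<in> space N" for x
    using that by (subst AE_iff_measurable[OF _ refl]) measurable
  moreover have "Measurable.pred N (\<lambda>x. emeasure P {y \<in> space P. \<not> Q x y} = 0)"
    by measurable
  ultimately show ?thesis
    by (simp cong: measurable_cong)
qed

definition exch :: "'n::finite set \<Rightarrow> (real^'n) \<times> (real^'n) \<Rightarrow> (real^'n) \<times> (real^'n)" where
  "exch S = (\<lambda>(x, y). (mix S x y, mix S y x))"

lemma exch_simp [simp]: "exch S (x, y) = (mix S x y, mix S y x)"
  by (simp add: exch_def)

lemma measurable_exch [measurable]: "exch S \<in> borel \<Otimes>\<^sub>M borel \<rightarrow>\<^sub>M borel \<Otimes>\<^sub>M borel"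
  unfolding exch_def by measurable

locale exchange_invariant = prob_space \<mu> for \<mu> :: "(real^'n) measure" +
  assumes sets_eq_borel [measurable_cong, simp]: "sets \<mu> = sets borel"
    and distr_exch: "distr (\<mu> \<Otimes>\<^sub>M \<mu>) (\<mu> \<Otimes>\<^sub>M \<mu>) (exch S) = \<mu> \<Otimes>\<^sub>M \<mu>"

text \<open>This generator suits the exchange: independence evaluates the product law on rectangles
  with Borel sides, and swapping coordinates maps rectangles to rectangles. It generates because it
  contains the open boxes.\<close>

lemma sets_eq_box_product:
  "sets (borel :: ((real^'n) \<times> (real^'n)) measure) =
     sigma_sets UNIV {{(x, y). \<forall>i. x $ i \<in> A i \<and> y $ i \<in> B i} |A B. (\<forall>i. A i \<in> sets borel) \<and> (\<forall>i. B i \<in> sets borel)}"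
    (is "_ = sigma_sets UNIV ?E")
proof
  have "box (a, b) (c, d) \<in> ?E" for a b c d :: "real^'n"
  proof -
    have "box (a, b) (c, d) = {(x, y). \<forall>i. x $ i \<in> {a $ i<..<c $ i} \<and> y $ i \<in> {b $ i<..<d $ i}}"
      by (auto simp: mem_box Basis_prod_def Basis_vec_def inner_axis ball_Un)
    moreover have "\<forall>i. {a $ i<..<c $ i} \<in> sets borel" "\<forall>i. {b $ i<..<d $ i} \<in> sets borel"
      by auto
    ultimately show ?thesis
      by (intro CollectI exI conjI)
  qed
  then have "range (\<lambda>(a, b). box a b) \<subseteq> ?E"
    by fastforce
  then show "sets (borel :: ((real^'n) \<times> (real^'n)) measure) \<subseteq> sigma_sets UNIV ?E"
    unfolding borel_eq_box by (simp add: sigma_sets_mono')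
  have "?E \<subseteq> sets borel"
  proof clarify
    fix A B :: "'n \<Rightarrow> real set"
    assume [measurable]: "\<forall>i. A i \<in> sets borel" "\<forall>i. B i \<in> sets borel"
    note [measurable] = borel_measurable_nth
    have "Measurable.pred (borel \<Otimes>\<^sub>M borel) (\<lambda>(x :: real^'n, y :: real^'n). \<forall>i. x $ i \<in> A i \<and> y $ i \<in> B i)"
      by measurable
    then show "{(x, y). \<forall>i. x $ i \<in> A i \<and> y $ i \<in> B i} \<in> sets borel"
      by (simp add: pred_def space_pair_measure borel_prod)
  qed
  from sets.sigma_sets_subset[OF this] show "sigma_sets UNIV ?E \<subseteq> sets borel"
    by (simp only: space_borel)
qed

text \<open>On a rectangle the product law is a product of marginal probabilities, one factor for
  each coordinate of the point and of the copy. An exchange only moves factors between the two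
  halves; the rest is uniqueness of measures on a generator stable under intersection.\<close>

lemma exchange_invariantI:
  fixes X :: "'a \<Rightarrow> real^'n"
  assumes "prob_space M" and X [measurable]: "X \<in> borel_measurable M"
    and indep: "prob_space.indep_vars M (\<lambda>_. borel) (\<lambda>i \<omega>. X \<omega> $ i) UNIV"
  shows "exchange_invariant (distr M borel X)"
proof -
  interpret M: prob_space M by fact
  let ?\<mu> = "distr M borel X"
  interpret prob_space ?\<mu> by (rule M.prob_space_distr) measurable
  interpret P: pair_prob_space ?\<mu> ?\<mu> ..
  note [measurable] = borel_measurable_nth
  define R where "R A = {x :: real^'n. \<forall>i. x $ i \<in> A i}" for A
  define p where "p i A = M.prob ((\<lambda>\<omega>. X \<omega> $ i) -` A \<inter> space M)" for i A
  have R_sets [measurable]: "R A \<in> sets borel" if [measurable]: "\<And>i. A i \<in> sets borel" for A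
  proof -
    have "Measurable.pred borel (\<lambda>x :: real^'n. \<forall>i. x $ i \<in> A i)"
      by measurable
    then show ?thesis
      by (simp add: pred_def R_def)
  qed
  have R: "emeasure ?\<mu> (R A) = ennreal (\<Prod>i\<in>UNIV. p i (A i))" if "\<And>i. A i \<in> sets borel" for A
  proof -
    have "M.prob (\<Inter>i. (\<lambda>\<omega>. X \<omega> $ i) -` A i \<inter> space M) = (\<Prod>i\<in>UNIV. p i (A i))"
      unfolding p_def by (rule M.indep_varsD_finite[OF indep]) (use that in auto)
    moreover have "(\<Inter>i. (\<lambda>\<omega>. X \<omega> $ i) -` A i \<inter> space M) = X -` R A \<inter> space M"
      by (auto simp: R_def)
    ultimately show ?thesis
      using that by (simp add: emeasure_distr R_sets M.emeasure_eq_measure)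
  qed
  have eq: "emeasure (distr (?\<mu> \<Otimes>\<^sub>M ?\<mu>) (?\<mu> \<Otimes>\<^sub>M ?\<mu>) (exch S)) (R A \<times> R B) = emeasure (?\<mu> \<Otimes>\<^sub>M ?\<mu>) (R A \<times> R B)"
    if [measurable]: "\<And>i. A i \<in> sets borel" "\<And>i. B i \<in> sets borel" for S A B
  proof -
    define A' where "A' i = (if i \<in> S then B i else A i)" for i
    define B' where "B' i = (if i \<in> S then A i else B i)" for i
    have [measurable]: "\<And>i. A' i \<in> sets borel" "\<And>i. B' i \<in> sets borel"
      by (simp_all add: A'_def B'_def)
    have "exch S -` (R A \<times> R B) \<inter> space (?\<mu> \<Otimes>\<^sub>M ?\<mu>) = R A' \<times> R B'"
      by (auto simp: R_def A'_def B'_def space_pair_measure split: if_splits) metis+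
    then have "emeasure (distr (?\<mu> \<Otimes>\<^sub>M ?\<mu>) (?\<mu> \<Otimes>\<^sub>M ?\<mu>) (exch S)) (R A \<times> R B) = emeasure (?\<mu> \<Otimes>\<^sub>M ?\<mu>) (R A' \<times> R B')"
      by (subst emeasure_distr) auto
    also have "\<dots> = ennreal ((\<Prod>i\<in>UNIV. p i (A' i)) * (\<Prod>i\<in>UNIV. p i (B' i)))"
      by (simp add: emeasure_pair_measure_Times R ennreal_mult prod_nonneg p_def)
    also have "(\<Prod>i\<in>UNIV. p i (A' i)) * (\<Prod>i\<in>UNIV. p i (B' i)) = (\<Prod>i\<in>UNIV. p i (A i)) * (\<Prod>i\<in>UNIV. p i (B i))"
      unfolding prod.distrib[symmetric] A'_def B'_def by (intro prod.cong) auto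
    also have "ennreal \<dots> = emeasure (?\<mu> \<Otimes>\<^sub>M ?\<mu>) (R A \<times> R B)"
      by (simp add: emeasure_pair_measure_Times R ennreal_mult prod_nonneg p_def)
    finally show ?thesis .
  qed
  show ?thesis
  proof
    fix S
    let ?E = "{{(x :: real^'n, y :: real^'n). \<forall>i. x $ i \<in> A i \<and> y $ i \<in> B i} |A B. (\<forall>i. A i \<in> sets borel) \<and> (\<forall>i. B i \<in> sets borel)}"
    have sets: "sets (?\<mu> \<Otimes>\<^sub>M ?\<mu>) = sigma_sets UNIV ?E"
    proof -
      have "sets (?\<mu> \<Otimes>\<^sub>M ?\<mu>) = sets (borel \<Otimes>\<^sub>M borel)"
        by (intro sets_pair_measure_cong) simp_all
      then show ?thesis
        unfolding borel_prod sets_eq_box_product .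
    qed
    have form: "{(x, y). \<forall>i. x $ i \<in> A i \<and> y $ i \<in> B i} = R A \<times> R B" for A B
      by (auto simp: R_def)
    show "distr (?\<mu> \<Otimes>\<^sub>M ?\<mu>) (?\<mu> \<Otimes>\<^sub>M ?\<mu>) (exch S) = ?\<mu> \<Otimes>\<^sub>M ?\<mu>"
    proof (rule measure_eqI_generator_eq[where E = ?E and \<Omega> = UNIV and A = "\<lambda>_. UNIV"])
      show "Int_stable ?E"
      proof (rule Int_stableI, clarify)
        fix A B A' B' :: "'n \<Rightarrow> real set"
        assume "\<forall>i. A i \<in> sets borel" "\<forall>i. B i \<in> sets borel" "\<forall>i. A' i \<in> sets borel" "\<forall>i. B' i \<in> sets borel"
        then show "\<exists>C D. {(x, y). \<forall>i. x $ i \<in> A i \<and> y $ i \<in> B i} \<inter> {(x, y). \<forall>i. x $ i \<in> A' i \<and> y $ i \<in> B' i} =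
          {(x, y). \<forall>i. x $ i \<in> C i \<and> y $ i \<in> D i} \<and> (\<forall>i. C i \<in> sets borel) \<and> (\<forall>i. D i \<in> sets borel)"
          by (intro exI[of _ "\<lambda>i. A i \<inter> A' i"] exI[of _ "\<lambda>i. B i \<inter> B' i"]) auto
      qed
      show "range (\<lambda>_. UNIV) \<subseteq> ?E"
        by (auto intro!: exI[of _ "\<lambda>_. UNIV"])
      show "emeasure (distr (?\<mu> \<Otimes>\<^sub>M ?\<mu>) (?\<mu> \<Otimes>\<^sub>M ?\<mu>) (exch S)) UNIV \<noteq> \<infinity>" for i :: nat
      proof -
        interpret D: prob_space "distr (?\<mu> \<Otimes>\<^sub>M ?\<mu>) (?\<mu> \<Otimes>\<^sub>M ?\<mu>) (exch S)"
          by (rule P.prob_space_distr) measurable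
        show ?thesis
          by (simp add: D.emeasure_eq_measure)
      qed
    qed (use eq in \<open>auto simp only: form sets sets_distr\<close>)
  qed simp
qed

section \<open>Transport of null sets and integrals by coordinate exchange\<close>

context exchange_invariant
begin

sublocale P: pair_prob_space \<mu> \<mu> ..

abbreviation "\<mu>2 \<equiv> \<mu> \<Otimes>\<^sub>M \<mu>"

lemma space_eq [simp]: "space \<mu> = UNIV"
  using sets_eq_imp_space_eq[OF sets_eq_borel] by simp

lemma integral_exch:
  fixes F :: "_ \<Rightarrow> real"
  assumes [measurable]: "F \<in> borel_measurable (borel \<Otimes>\<^sub>M borel)"
  shows "(\<integral>z. F (exch S z) \<partial>\<mu>2) = (\<integral>z. F z \<partial>\<mu>2)"
proof -
  have "(\<integral>z. F z \<partial>distr \<mu>2 \<mu>2 (exch S)) = (\<integral>z. F (exch S z) \<partial>\<mu>2)"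
    by (rule integral_distr) measurable
  then show ?thesis
    by (simp add: distr_exch)
qed

lemma AE_exch:
  assumes [measurable]: "Measurable.pred (borel \<Otimes>\<^sub>M borel) Q"
    and Q: "AE z in \<mu>2. Q z"
  shows "AE z in \<mu>2. Q (exch S z)"
proof -
  have "AE z in distr \<mu>2 \<mu>2 (exch S). Q z"
    unfolding distr_exch by (rule Q)
  then show ?thesis
    by (subst (asm) AE_distr_iff) measurable
qed

lemma AE_fst:
  assumes [measurable]: "Measurable.pred borel Q" and "AE x in \<mu>. Q x"
  shows "AE z in \<mu>2. Q (fst z)"
  proof (rule P.AE_pair_measure)
  show "{z \<in> space \<mu>2. Q (fst z)} \<in> sets \<mu>2"
    by measurable
qed (use assms(2) in simp)

text \<open>The mixed point is the first component of \<open>exch S z\<close>, hence again has law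
  \<open>\<mu>\<close>.\<close>

lemma AE_mix:
  assumes [measurable]: "Measurable.pred borel Q" and "AE x in \<mu>. Q x"
  shows "AE z in \<mu>2. Q (mix S (fst z) (snd z))"
  using AE_exch[OF _ AE_fst[OF assms], of S] by (simp add: exch_def split_beta)

lemma integral_fst:
  fixes h :: "_ \<Rightarrow> real"
  assumes [measurable]: "h \<in> borel_measurable borel"
  shows "(\<integral>z. h (fst z) \<partial>\<mu>2) = (\<integral>x. h x \<partial>\<mu>)"
proof -
  have "(\<integral>z. h (fst z) \<partial>\<mu>2) = (\<integral>x. h x \<partial>distr \<mu>2 \<mu> fst)"
    by (rule integral_distr[symmetric]) measurable
  also have "distr \<mu>2 \<mu> fst = \<mu>"
    by (rule distr_pair_fst)
  finally show ?thesis .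
qed

lemma integral_mix:
  fixes h :: "_ \<Rightarrow> real"
  assumes [measurable]: "h \<in> borel_measurable borel"
  shows "(\<integral>z. h (mix S (fst z) (snd z)) \<partial>\<mu>2) = (\<integral>x. h x \<partial>\<mu>)"
  using integral_exch[of "\<lambda>z. h (fst z)" S] by (simp add: exch_def split_beta integral_fst)

end

section \<open>Interpolation over subsets\<close>

text \<open>The law of the random subset of \<open>A\<close> that contains each element
  independently with probability \<open>s\<close>.\<close>

definition bern :: "real \<Rightarrow> 'a set \<Rightarrow> 'a set \<Rightarrow> real" where
  "bern s A S = (\<Prod>i\<in>A. if i \<in> S then s else 1 - s)"

definition bern_mean :: "real \<Rightarrow> 'a set \<Rightarrow> ('a set \<Rightarrow> real) \<Rightarrow> real" where
  "bern_mean s A c = (\<Sum>S\<in>Pow A. bern s A S * c S)"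

lemma bern_mean_empty [simp]: "bern_mean s {} c = c {}"
  by (simp add: bern_mean_def bern_def)

lemma bern_mean_insert:
  assumes "finite A" "a \<notin> A"
  shows "bern_mean s (insert a A) c = (1 - s) * bern_mean s A c + s * bern_mean s A (\<lambda>S. c (insert a S))"
proof -
  have 1: "bern s (insert a A) S = (1 - s) * bern s A S" if "S \<in> Pow A" for S
    using assms that by (auto simp: bern_def)
  have 2: "bern s (insert a A) (insert a S) = s * bern s A S" if "S \<in> Pow A" for S
    using assms that by (auto simp: bern_def intro!: prod.cong)
  have inj: "inj_on (insert a) (Pow A)"
    using assms(2) by (intro inj_onI) (metis Pow_iff insert_ident subsetD)
  have "bern_mean s (insert a A) c = (\<Sum>S\<in>Pow A. bern s (insert a A) S * c S)
      + (\<Sum>S\<in>insert a ` Pow A. bern s (insert a A) S * c S)"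
    unfolding bern_mean_def Pow_insert using assms by (intro sum.union_disjoint) auto
  also have "\<dots> = (\<Sum>S\<in>Pow A. (1 - s) * (bern s A S * c S)) + (\<Sum>S\<in>Pow A. s * (bern s A S * c (insert a S)))"
    unfolding sum.reindex[OF inj] by (intro arg_cong2[where f = "(+)"] sum.cong) (simp_all add: 1 2 del: Pow_iff)
  finally show ?thesis
    by (simp add: bern_mean_def sum_distrib_left)
qed

lemma bern_mean_add: "bern_mean s A (\<lambda>S. c S + d S) = bern_mean s A c + bern_mean s A d"
  by (simp add: bern_mean_def algebra_simps sum.distrib)

lemma bern_mean_diff: "bern_mean s A (\<lambda>S. c S - d S) = bern_mean s A c - bern_mean s A d"
  by (simp add: bern_mean_def algebra_simps sum_subtractf)

lemma bern_mean_cong: "(\<And>S. S \<subseteq> A \<Longrightarrow> c S = d S) \<Longrightarrow> bern_mean s A c = bern_mean s A d"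
  unfolding bern_mean_def by (intro sum.cong) auto

lemma bern_mean_const:
  "finite A \<Longrightarrow> bern_mean s A (\<lambda>_. k) = k"
  by (induction A rule: finite_induct) (auto simp: bern_mean_insert algebra_simps)

lemma bern_mean_0: "finite A \<Longrightarrow> bern_mean 0 A c = c {}"
  by (induction A arbitrary: c rule: finite_induct) (auto simp: bern_mean_insert)

lemma bern_mean_1: "finite A \<Longrightarrow> bern_mean 1 A c = c A"
  by (induction A arbitrary: c rule: finite_induct) (auto simp: bern_mean_insert)

lemma bern_mean_mono:
  assumes "0 \<le> s" "s \<le> 1" "\<And>S. S \<subseteq> A \<Longrightarrow> c S \<le> d S"
  shows "bern_mean s A c \<le> bern_mean s A d"
  unfolding bern_mean_def bern_def
  using assms by (intro sum_mono mult_left_mono prod_nonneg) auto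

text \<open>Russo's formula. The induction conditions on whether the new element \<open>a\<close>
  lies in the random set; the difference at \<open>a\<close> arises from differentiating the weights
  \<open>1 - s\<close> and \<open>s\<close>.\<close>

lemma DERIV_bern_mean:
  assumes "finite A"
  shows "((\<lambda>s. bern_mean s A c) has_real_derivative
    bern_mean s A (\<lambda>S. \<Sum>i\<in>A. c (insert i S) - c (S - {i}))) (at s)"
  using assms
proof (induction A arbitrary: c rule: finite_induct)
  case (insert a A)
  let ?c = "\<lambda>S. c (insert a S)"
  let ?D = "\<lambda>c. bern_mean s A (\<lambda>S. \<Sum>i\<in>A. c (insert i S) - c (S - {i}))"
  \<comment> \<open>The difference at \<open>a\<close> is the same whether or not \<open>a\<close>
    is in the set, so it appears identically in \<open>1\<close> and \<open>2\<close>, and the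
    weights \<open>1 - s\<close> and \<open>s\<close> add up to one copy of it.\<close>
  have 1: "bern_mean s A (\<lambda>S. \<Sum>i\<in>insert a A. c (insert i S) - c (S - {i})) =
      bern_mean s A ?c - bern_mean s A c + ?D c"
    unfolding bern_mean_add[symmetric] bern_mean_diff[symmetric]
    using insert.hyps
    by (intro bern_mean_cong) (subst sum.insert, auto intro!: arg_cong[where f = c])
  have 2: "bern_mean s A (\<lambda>S. \<Sum>i\<in>insert a A. c (insert i (insert a S)) - c (insert a S - {i})) =
      bern_mean s A ?c - bern_mean s A c + ?D ?c"
    unfolding bern_mean_add[symmetric] bern_mean_diff[symmetric]
  proof (intro bern_mean_cong)
    fix S assume "S \<subseteq> A"
    then have "a \<notin> S" "\<And>i. i \<in> A \<Longrightarrow> insert a S - {i} = insert a (S - {i})"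
      using insert.hyps by auto
    then show "(\<Sum>i\<in>insert a A. c (insert i (insert a S)) - c (insert a S - {i})) =
        c (insert a S) - c S + (\<Sum>i\<in>A. c (insert a (insert i S)) - c (insert a (S - {i})))"
      using insert.hyps by (simp add: insert_commute)
  qed
  have "((\<lambda>s. (1 - s) * bern_mean s A c + s * bern_mean s A ?c) has_real_derivative
      (1 - s) * ?D c - bern_mean s A c + (s * ?D ?c + bern_mean s A ?c)) (at s)"
    by (auto intro!: derivative_eq_intros insert.IH)
  also have "(\<lambda>s. (1 - s) * bern_mean s A c + s * bern_mean s A ?c) = (\<lambda>s. bern_mean s (insert a A) c)"
    using insert.hyps by (simp add: bern_mean_insert)
  also have "(1 - s) * ?D c - bern_mean s A c + (s * ?D ?c + bern_mean s A ?c) =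
      bern_mean s (insert a A) (\<lambda>S. \<Sum>i\<in>insert a A. c (insert i S) - c (S - {i}))"
    unfolding bern_mean_insert[OF insert.hyps] 1 2 by (simp add: algebra_simps)
  finally show ?case .
qed simp

text \<open>The mean value theorem in \<open>s\<close>, from the empty set at \<open>s = 0\<close>
  to \<open>A\<close> at \<open>s = 1\<close>. One unknown \<open>s\<close> serves as well as an
  integral over \<open>s\<close>, since the sum over \<open>i\<close> will be bounded for each fixed
  \<open>S\<close>.\<close>

lemma subset_interpolation:
  assumes "finite A"
  obtains s where "0 \<le> s" "s \<le> 1"
    "c {} - c A = bern_mean s A (\<lambda>S. \<Sum>i\<in>A. c (S - {i}) - c (insert i S))"
proof -
  obtain s where "0 < s" "s < 1" and s: "bern_mean 1 A c - bern_mean 0 A c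
      = (1 - 0) * bern_mean s A (\<lambda>S. \<Sum>i\<in>A. c (insert i S) - c (S - {i}))"
    using MVT2[of 0 1 "\<lambda>s. bern_mean s A c", OF _ DERIV_bern_mean[OF assms]] by auto
  have "c {} - c A = - bern_mean s A (\<lambda>S. \<Sum>i\<in>A. c (insert i S) - c (S - {i}))"
    using s assms by (simp add: bern_mean_0 bern_mean_1)
  also have "\<dots> = bern_mean s A (\<lambda>S. \<Sum>i\<in>A. c (S - {i}) - c (insert i S))"
    by (simp add: bern_mean_def sum_negf[symmetric] sum_subtractf algebra_simps)
  finally show ?thesis
    using that[of s] \<open>0 < s\<close> \<open>s < 1\<close> by simp
qed

section \<open>Moments of functions of independent variables\<close>

text \<open>The factor complementary to \<open>a - b\<close> has 2k + 1 terms, each at most the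
  2k-th power of the larger absolute value, which is one of the two even powers on the
  right.\<close>

lemma power_diff_le:
  fixes a b :: real
  shows "\<bar>a ^ (2 * k + 1) - b ^ (2 * k + 1)\<bar> \<le> (2 * real k + 1) * (a ^ (2 * k) + b ^ (2 * k)) * \<bar>a - b\<bar>"
proof -
  define c where "c = max \<bar>a\<bar> \<bar>b\<bar>"
  have "\<bar>\<Sum>i<2 * k + 1. b ^ (2 * k + 1 - Suc i) * a ^ i\<bar> \<le> (\<Sum>i<2 * k + 1. c ^ (2 * k))"
  proof (rule order.trans[OF sum_abs], rule sum_mono)
    fix i assume i: "i \<in> {..<2 * k + 1}"
    have "\<bar>b ^ (2 * k + 1 - Suc i) * a ^ i\<bar> = \<bar>b\<bar> ^ (2 * k - i) * \<bar>a\<bar> ^ i"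
      by (simp add: abs_mult power_abs)
    also have "\<dots> \<le> c ^ (2 * k - i) * c ^ i"
      by (intro mult_mono power_mono) (auto simp: c_def)
    also have "\<dots> = c ^ (2 * k)"
      using i by (simp flip: power_add)
    finally show "\<bar>b ^ (2 * k + 1 - Suc i) * a ^ i\<bar> \<le> c ^ (2 * k)" .
  qed
  also have "\<dots> = (2 * real k + 1) * c ^ (2 * k)"
    by simp
  also have "c ^ (2 * k) \<le> a ^ (2 * k) + b ^ (2 * k)"
    by (auto simp: c_def max_def power_even_abs)
  finally have "\<bar>\<Sum>i<2 * k + 1. b ^ (2 * k + 1 - Suc i) * a ^ i\<bar> \<le> (2 * real k + 1) * (a ^ (2 * k) + b ^ (2 * k))"
    by (simp add: mult_left_mono)
  then show ?thesis
    unfolding power_diff_sumr2 abs_mult by (subst mult.commute) (intro mult_right_mono, auto)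
qed

text \<open>Young's inequality with exponents (k + 1)/k and k + 1. The induction multiplies the
  previous case by \<open>a\<close> and adds the product of \<open>a ^ Suc k - b ^ Suc k\<close> and
  \<open>a - b\<close>, two factors of equal sign.\<close>

lemma Youngs_inequality_power:
  fixes a b :: real
  assumes "0 \<le> a" "0 \<le> b"
  shows "(real k + 1) * (a ^ k * b) \<le> real k * a ^ Suc k + b ^ Suc k"
proof (induction k)
  case (Suc k)
  have "0 \<le> (a ^ Suc k - b ^ Suc k) * (a - b)"
    using assms power_mono[of a b "Suc k"] power_mono[of b a "Suc k"]
    by (cases a b rule: le_cases) (simp_all add: zero_le_mult_iff del: power_Suc)
  moreover have "(real k + 1) * (a ^ Suc k * b) \<le> real k * a ^ Suc (Suc k) + a * b ^ Suc k"
    using mult_left_mono[OF Suc assms(1)] by (simp add: algebra_simps)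
  ultimately show ?case
    by (simp add: algebra_simps)
qed simp

text \<open>Boundedness at every point, unlike an almost sure bound, survives substitution of any
  map, so integrability at mixed points follows from closure rules alone.\<close>

definition bdd_fun :: "('a \<Rightarrow> real) \<Rightarrow> bool" where
  "bdd_fun F \<longleftrightarrow> (\<exists>C. \<forall>x. \<bar>F x\<bar> \<le> C)"

named_theorems bdd_intros

lemma bdd_fun_const [bdd_intros]: "bdd_fun (\<lambda>_. c)"
  by (auto simp: bdd_fun_def)

lemma bdd_fun_add [bdd_intros]: "bdd_fun F \<Longrightarrow> bdd_fun G \<Longrightarrow> bdd_fun (\<lambda>x. F x + G x)"
  unfolding bdd_fun_def by (meson abs_triangle_ineq add_mono order_trans)

lemma bdd_fun_mult [bdd_intros]: "bdd_fun F \<Longrightarrow> bdd_fun G \<Longrightarrow> bdd_fun (\<lambda>x. F x * G x)"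
  unfolding bdd_fun_def abs_mult by (meson abs_ge_zero mult_mono order_trans)

lemma bdd_fun_diff [bdd_intros]: "bdd_fun F \<Longrightarrow> bdd_fun G \<Longrightarrow> bdd_fun (\<lambda>x. F x - G x)"
  using bdd_fun_add[of F "\<lambda>x. - 1 * G x"] bdd_fun_mult[of "\<lambda>_. - 1" G] by (simp add: bdd_fun_const)

lemma bdd_fun_divide [bdd_intros]: "bdd_fun F \<Longrightarrow> bdd_fun (\<lambda>x. F x / c)"
  using bdd_fun_mult[of F "\<lambda>_. inverse c"] by (simp add: bdd_fun_const divide_inverse)

lemma bdd_fun_power [bdd_intros]: "bdd_fun F \<Longrightarrow> bdd_fun (\<lambda>x. F x ^ n)"
  by (induction n) (auto intro: bdd_intros)

lemma bdd_fun_sum [bdd_intros]: "(\<And>i. i \<in> I \<Longrightarrow> bdd_fun (F i)) \<Longrightarrow> bdd_fun (\<lambda>x. \<Sum>i\<in>I. F i x)"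
  by (induction I rule: infinite_finite_induct) (auto intro: bdd_intros)

lemma bdd_fun_comp: "bdd_fun F \<Longrightarrow> bdd_fun (\<lambda>x. F (g x))"
  by (auto simp: bdd_fun_def)

lemma (in finite_measure) integrable_bdd_fun:
  "bdd_fun F \<Longrightarrow> F \<in> borel_measurable M \<Longrightarrow> integrable M F"
  unfolding bdd_fun_def using integrable_const_bound by (metis AE_I2 real_norm_def)

lemma mix_empty [simp]: "mix {} x y = x" and mix_UNIV [simp]: "mix UNIV x y = y"
  by (simp_all add: vec_eq_iff)

context exchange_invariant
begin

text \<open>\<open>\<integral>\<integral> f\<^bsup>2k+1\<^esup>(x) f(x\<^sup>S)\<close> goes from \<open>\<integral> f\<^bsup>2k+2\<^esup>\<close> for \<open>S = {}\<close> to \<open>0\<close> for the full set. Averaging over random \<open>S\<close>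
  whose law does not depend on the exchanged coordinate \<open>i\<close> keeps the sum over \<open>i\<close> of
  \<open>H i x * H i (x\<^sup>S)\<close> at the common point \<open>x\<^sup>S\<close>, so that it is controlled by the norms of \<open>H\<close> at \<open>x\<close> and \<open>x\<^sup>S\<close>.\<close>

lemma moment_bound_centered:
  fixes f :: "real^'n \<Rightarrow> real" and H :: "'n \<Rightarrow> real^'n \<Rightarrow> real"
  assumes f [measurable]: "f \<in> borel_measurable borel" and bf: "bdd_fun f"
    and H [measurable]: "\<And>i. H i \<in> borel_measurable borel" and bH: "\<And>i. bdd_fun (H i)"
    and H_nonneg: "\<And>i x. 0 \<le> H i x"
    and H_mix: "\<And>i x y. H i (mix {i} x y) = H i x"
    and diff: "\<And>i. AE z in \<mu>2. \<bar>f (fst z) - f (mix {i} (fst z) (snd z))\<bar> \<le> 2 * H i (fst z)"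
    and mean: "(\<integral>x. f x \<partial>\<mu>) = 0"
  shows "(\<integral>x. f x ^ (2 * Suc k) \<partial>\<mu>) \<le>
    (4 * (2 * real k + 1)) ^ Suc k * (\<integral>x. (\<Sum>i\<in>UNIV. (H i x)\<^sup>2) ^ Suc k \<partial>\<mu>)"
proof -
  define A where "A = 4 * (2 * real k + 1)"
  define Q where "Q x = (\<Sum>i\<in>UNIV. (H i x)\<^sup>2)" for x
  define m where "m S z = mix S (fst z) (snd z)" for S and z :: "(real^'n) \<times> (real^'n)"
  define c where "c S = (\<integral>z. f (fst z) ^ (2 * k + 1) * f (m S z) \<partial>\<mu>2)" for S
  have [measurable]: "m S \<in> borel \<Otimes>\<^sub>M borel \<rightarrow>\<^sub>M borel" for S
    unfolding m_def by measurable
  have Q [measurable]: "Q \<in> borel_measurable borel"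
    unfolding Q_def by measurable
  have bQ: "bdd_fun Q"
    unfolding Q_def by (intro bdd_intros bH)
  note bdd = bdd_intros bdd_fun_comp[OF bf] bdd_fun_comp[OF bH] bdd_fun_comp[OF bQ]
  have int2: "integrable \<mu>2 F" if "bdd_fun F" "F \<in> borel_measurable (borel \<Otimes>\<^sub>M borel)" for F
    by (rule P.integrable_bdd_fun) (use that in measurable)
  have c_empty: "c {} = (\<integral>x. f x ^ (2 * Suc k) \<partial>\<mu>)"
    unfolding c_def by (subst integral_fst[symmetric]) (auto simp: m_def algebra_simps)
  have c_UNIV: "c UNIV = 0"
  proof -
    have "c UNIV = (\<integral>x. \<integral>y. f x ^ (2 * k + 1) * f y \<partial>\<mu> \<partial>\<mu>)"
      using P.integral_fst'[OF int2, of "\<lambda>z. f (fst z) ^ (2 * k + 1) * f (snd z)"]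
      by (simp add: c_def m_def bdd del: power_Suc)
    then show ?thesis
      by (simp add: mean)
  qed
  \<comment> \<open>Since \<open>H i\<close> ignores coordinate \<open>i\<close>, it does not see
    whether \<open>i\<close> belongs to \<open>S\<close>.\<close>
  have H_m: "H i (m (S - {i}) z) = H i (m S z)" for i S z
  proof -
    have "m S z = m (S - {i}) z \<or> m S z = mix {i} (m (S - {i}) z) (snd z)"
      by (auto simp: m_def vec_eq_iff)
    then show ?thesis
      using H_mix by metis
  qed
  have step: "c (S - {i}) - c (insert i S) \<le> A * (\<integral>z. f (fst z) ^ (2 * k) * (H i (fst z) * H i (m S z)) \<partial>\<mu>2)"
    for i S
  proof -
    define D where "D z = f (m (S - {i}) z) - f (m (insert i S) z)" for z
    define F where "F z = f (fst z) ^ (2 * k) * (H i (fst z) * H i (m S z))" for z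
    have [measurable]: "D \<in> borel_measurable (borel \<Otimes>\<^sub>M borel)" "F \<in> borel_measurable (borel \<Otimes>\<^sub>M borel)"
      unfolding D_def F_def by measurable
    have bD: "bdd_fun D" and bF: "bdd_fun F"
      unfolding D_def F_def by (intro bdd)+
    \<comment> \<open>Swapping coordinate \<open>i\<close> of the pair exchanges the two points
      compared by \<open>D\<close>, which flips its sign, and turns the first point into the one
      resampled at \<open>i\<close>.\<close>
    have m_exch: "m (S - {i}) (exch {i} z) = m (insert i S) z" "m (insert i S) (exch {i} z) = m (S - {i}) z"
      "fst (exch {i} z) = m {i} z" "m S (exch {i} z) = mix {i} (m S z) (mix S (snd z) (fst z))" for z
      by (cases z; auto simp: m_def vec_eq_iff)+
    have D_exch: "D (exch {i} z) = - D z" for z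
      by (simp add: D_def m_exch)
    have F_exch: "F (exch {i} z) = f (m {i} z) ^ (2 * k) * (H i (fst z) * H i (m S z))" for z
      by (simp add: F_def m_exch H_mix) (simp add: m_def H_mix)
    \<comment> \<open>The hypothesis on increments is applied to the pair after exchanging
      \<open>S - {i}\<close>, whose first component is the mixed point.\<close>
    have AE_D: "AE z in \<mu>2. \<bar>D z\<bar> \<le> 2 * H i (m S z)"
    proof -
      have "AE z in \<mu>2. \<bar>f (fst (exch (S - {i}) z)) - f (m {i} (exch (S - {i}) z))\<bar> \<le> 2 * H i (fst (exch (S - {i}) z))"
        using diff[of i] by (intro AE_exch) (auto simp: m_def)
      moreover have "fst (exch (S - {i}) z) = m (S - {i}) z" "m {i} (exch (S - {i}) z) = m (insert i S) z" for z
        by (cases z; auto simp: m_def vec_eq_iff)+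
      ultimately show ?thesis
        by (simp add: D_def H_m)
    qed
    have AE: "AE z in \<mu>2. (f (fst z) ^ (2 * k + 1) - f (m {i} z) ^ (2 * k + 1)) * D z \<le> A * (F z + F (exch {i} z))"
      using AE_D diff[of i]
    proof eventually_elim
      case (elim z)
      have "(f (fst z) ^ (2 * k + 1) - f (m {i} z) ^ (2 * k + 1)) * D z
          \<le> \<bar>f (fst z) ^ (2 * k + 1) - f (m {i} z) ^ (2 * k + 1)\<bar> * \<bar>D z\<bar>"
        by (metis abs_ge_self abs_mult)
      also have "\<dots> \<le> ((2 * real k + 1) * (f (fst z) ^ (2 * k) + f (m {i} z) ^ (2 * k)) * \<bar>f (fst z) - f (m {i} z)\<bar>) * \<bar>D z\<bar>"
        by (intro mult_right_mono power_diff_le) auto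
      also have "\<dots> \<le> ((2 * real k + 1) * (f (fst z) ^ (2 * k) + f (m {i} z) ^ (2 * k)) * (2 * H i (fst z))) * (2 * H i (m S z))"
        using elim H_nonneg by (intro mult_mono) (auto simp: m_def)
      also have "\<dots> = A * (F z + F (exch {i} z))"
        by (simp add: F_exch) (simp add: A_def F_def algebra_simps)
      finally show ?case .
    qed
    have gD: "c (S - {i}) - c (insert i S) = (\<integral>z. f (fst z) ^ (2 * k + 1) * D z \<partial>\<mu>2)"
      unfolding c_def D_def
      by (subst Bochner_Integration.integral_diff[symmetric]) (auto intro!: int2 bdd simp: algebra_simps)
    \<comment> \<open>The integral equals minus its image under the exchange, hence half the
      difference; this produces the increment of the odd power of \<open>f\<close>.\<close>
    also have "\<dots> = ((\<integral>z. f (fst z) ^ (2 * k + 1) * D z \<partial>\<mu>2) - (\<integral>z. f (m {i} z) ^ (2 * k + 1) * D z \<partial>\<mu>2)) / 2"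
      using integral_exch[of "\<lambda>z. f (fst z) ^ (2 * k + 1) * D z" "{i}"]
      by (simp add: D_exch m_exch)
    also have "\<dots> = (\<integral>z. (f (fst z) ^ (2 * k + 1) - f (m {i} z) ^ (2 * k + 1)) * D z \<partial>\<mu>2) / 2"
      by (subst Bochner_Integration.integral_diff[symmetric])
         (auto intro!: int2 bdd bD simp: algebra_simps)
    also have "\<dots> \<le> (\<integral>z. A * (F z + F (exch {i} z)) \<partial>\<mu>2) / 2"
      by (intro divide_right_mono integral_mono_AE[OF _ _ AE] int2)
         (auto intro!: bdd bD bF bdd_fun_comp[OF bF])
    also have "\<dots> = A * ((\<integral>z. F z \<partial>\<mu>2) + (\<integral>z. F (exch {i} z) \<partial>\<mu>2)) / 2"
      by (subst Bochner_Integration.integral_add[symmetric]) (auto intro!: int2 bF bdd_fun_comp[OF bF])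
    \<comment> \<open>Both integrals agree by invariance, which cancels the 1/2. What remains in
      \<open>A\<close> is 2k + 1 from the odd power and a factor 2 from each of the two
      increments.\<close>
    also have "\<dots> = A * (\<integral>z. F z \<partial>\<mu>2)"
      by (simp add: integral_exch)
    finally show ?thesis
      by (simp add: F_def)
  qed
  have total: "(\<Sum>i\<in>UNIV. c (S - {i}) - c (insert i S)) * real (Suc k) \<le>
      real k * (\<integral>x. f x ^ (2 * Suc k) \<partial>\<mu>) + A ^ Suc k * (\<integral>x. Q x ^ Suc k \<partial>\<mu>)" for S
  proof -
    \<comment> \<open>The product of the two \<open>H\<close> values splits into squares at the two
      points, and Young's inequality is applied to \<open>f\<^sup>2\<close> and \<open>A * Q\<close>
      at each. Both points have law \<open>\<mu>\<close>, so the two halves will integrate to the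
      same value.\<close>
    have pt: "real (Suc k) * (A * (\<Sum>i\<in>UNIV. f (fst z) ^ (2 * k) * (H i (fst z) * H i (m S z))))
        \<le> real k * f (fst z) ^ (2 * Suc k) + (A ^ Suc k * Q (fst z) ^ Suc k + A ^ Suc k * Q (m S z) ^ Suc k) / 2" for z
    proof -
      have Y: "real (Suc k) * (((f (fst z))\<^sup>2) ^ k * (A * Q u)) \<le> real k * ((f (fst z))\<^sup>2) ^ Suc k + (A * Q u) ^ Suc k" for u
        using Youngs_inequality_power[of "(f (fst z))\<^sup>2" "A * Q u" k]
        by (simp add: A_def Q_def sum_nonneg algebra_simps)
      have avg: "(a + b) / 2 \<le> c + (d + e) / 2" if "a \<le> c + d" "b \<le> c + e" for a b c d e :: real
        using that by (simp add: field_simps)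
      have "(\<Sum>i\<in>UNIV. H i (fst z) * H i (m S z)) \<le> (\<Sum>i\<in>UNIV. ((H i (fst z))\<^sup>2 + (H i (m S z))\<^sup>2) / 2)"
      proof (rule sum_mono)
        fix i
        show "H i (fst z) * H i (m S z) \<le> ((H i (fst z))\<^sup>2 + (H i (m S z))\<^sup>2) / 2"
          using sum_squares_bound[of "H i (fst z)" "H i (m S z)"] by simp
      qed
      also have "\<dots> = (Q (fst z) + Q (m S z)) / 2"
        by (simp add: Q_def sum.distrib flip: sum_divide_distrib)
      finally have "real (Suc k) * (A * (((f (fst z))\<^sup>2) ^ k * (\<Sum>i\<in>UNIV. H i (fst z) * H i (m S z))))
          \<le> real (Suc k) * (A * (((f (fst z))\<^sup>2) ^ k * ((Q (fst z) + Q (m S z)) / 2)))"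
        by (intro mult_left_mono) (auto simp: A_def)
      also have "\<dots> = (real (Suc k) * (((f (fst z))\<^sup>2) ^ k * (A * Q (fst z))) +
          real (Suc k) * (((f (fst z))\<^sup>2) ^ k * (A * Q (m S z)))) / 2"
        by (simp only: add_divide_distrib distrib_left times_divide_eq_right mult_ac)
      also have "\<dots> \<le> real k * ((f (fst z))\<^sup>2) ^ Suc k + ((A * Q (fst z)) ^ Suc k + (A * Q (m S z)) ^ Suc k) / 2"
        by (rule avg[OF Y Y])
      finally show ?thesis
        by (simp only: power_mult_distrib power_mult sum_distrib_left)
    qed
    have "(\<Sum>i\<in>UNIV. c (S - {i}) - c (insert i S)) * real (Suc k) \<le>
        (\<Sum>i\<in>UNIV. A * (\<integral>z. f (fst z) ^ (2 * k) * (H i (fst z) * H i (m S z)) \<partial>\<mu>2)) * real (Suc k)"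
      by (intro mult_right_mono sum_mono step) auto
    also have "\<dots> = (\<integral>z. real (Suc k) * (A * (\<Sum>i\<in>UNIV. f (fst z) ^ (2 * k) * (H i (fst z) * H i (m S z)))) \<partial>\<mu>2)"
    proof -
      have "(\<integral>z. (\<Sum>i\<in>UNIV. f (fst z) ^ (2 * k) * (H i (fst z) * H i (m S z))) \<partial>\<mu>2) =
          (\<Sum>i\<in>UNIV. \<integral>z. f (fst z) ^ (2 * k) * (H i (fst z) * H i (m S z)) \<partial>\<mu>2)"
        by (rule Bochner_Integration.integral_sum) (auto intro!: int2 bdd)
      then show ?thesis
        by (simp only: integral_mult_right_zero) (simp only: sum_distrib_left[symmetric] mult.commute)
    qed
    also have "\<dots> \<le> (\<integral>z. real k * f (fst z) ^ (2 * Suc k) + (A ^ Suc k * Q (fst z) ^ Suc k + A ^ Suc k * Q (m S z) ^ Suc k) / 2 \<partial>\<mu>2)"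
      by (rule integral_mono[OF int2 int2 pt]) (measurable, intro bdd, measurable, intro bdd, measurable)
    also have "\<dots> = real k * (\<integral>z. f (fst z) ^ (2 * Suc k) \<partial>\<mu>2) +
        (A ^ Suc k * (\<integral>z. Q (fst z) ^ Suc k \<partial>\<mu>2) + A ^ Suc k * (\<integral>z. Q (m S z) ^ Suc k \<partial>\<mu>2)) / 2"
    proof -
      have i1: "integrable \<mu>2 (\<lambda>z. f (fst z) ^ (2 * Suc k))" and i2: "integrable \<mu>2 (\<lambda>z. Q (fst z) ^ Suc k)"
        and i3: "integrable \<mu>2 (\<lambda>z. Q (m S z) ^ Suc k)"
        by (auto intro!: int2 bdd simp del: power_Suc)
      show ?thesis
        using i1 i2 i3 by (simp del: power_Suc)
    qed
    also have "\<dots> = real k * (\<integral>x. f x ^ (2 * Suc k) \<partial>\<mu>) + A ^ Suc k * (\<integral>x. Q x ^ Suc k \<partial>\<mu>)"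
      using integral_fst[of "\<lambda>x. f x ^ (2 * Suc k)"] integral_fst[of "\<lambda>x. Q x ^ Suc k"]
        integral_mix[of "\<lambda>x. Q x ^ Suc k" S] by (simp add: m_def del: power_Suc)
    finally show ?thesis .
  qed
  obtain s where s: "0 \<le> s" "s \<le> 1"
    "c {} - c UNIV = bern_mean s UNIV (\<lambda>S. \<Sum>i\<in>UNIV. c (S - {i}) - c (insert i S))"
    by (rule subset_interpolation[OF finite])
  let ?E = "\<integral>x. f x ^ (2 * Suc k) \<partial>\<mu>" and ?R = "A ^ Suc k * (\<integral>x. Q x ^ Suc k \<partial>\<mu>)"
  have "?E = bern_mean s UNIV (\<lambda>S. \<Sum>i\<in>UNIV. c (S - {i}) - c (insert i S))"
    using s c_empty c_UNIV by simp
  also have "\<dots> \<le> bern_mean s UNIV (\<lambda>S :: 'n set. (real k * ?E + ?R) / real (Suc k))"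
  proof (rule bern_mean_mono)
    fix S
    show "(\<Sum>i\<in>UNIV. c (S - {i}) - c (insert i S)) \<le> (real k * ?E + ?R) / real (Suc k)"
      using total[of S] by (subst pos_le_divide_eq) (simp_all only: of_nat_0_less_iff zero_less_Suc)
  qed (rule s)+
  also have "\<dots> = (real k * ?E + ?R) / real (Suc k)"
    by (rule bern_mean_const) simp
  \<comment> \<open>Young's inequality returns only the fraction k/(k + 1) of the moment, so it can
    be absorbed on the left.\<close>
  finally have "?E * (real k + 1) \<le> real k * ?E + ?R"
    by (simp only: pos_le_divide_eq of_nat_0_less_iff zero_less_Suc of_nat_Suc add.commute)
  then have "?E \<le> ?R"
    by (simp add: distrib_left del: power_Suc)
  then show ?thesis
    by (simp only: A_def Q_def)
qed

end

section \<open>Partial essential suprema\<close>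

lemma T_op_mix: "T_op i F (x, y) = F (mix {i} x y, y)"
  by (simp add: T_op_def mix_def)

lemma measurable_T_op [measurable]:
  assumes [measurable]: "F \<in> borel_measurable (borel \<Otimes>\<^sub>M borel)"
  shows "T_op i F \<in> borel_measurable (borel \<Otimes>\<^sub>M borel)"
proof -
  have "T_op i F = (\<lambda>z. F (mix {i} (fst z) (snd z), snd z))"
    by (auto simp: T_op_mix)
  also have "\<dots> \<in> borel_measurable (borel \<Otimes>\<^sub>M borel)"
    by measurable
  finally show ?thesis .
qed

lemma diff_op_Nil [simp]: "diff_op [] F = F"
  and diff_op_Cons: "diff_op (i # is) F = (\<lambda>z. diff_op is F z - T_op i (diff_op is F) z)"
  by (simp_all add: diff_op_def)

lemma measurable_diff_op [measurable]:
  assumes "F \<in> borel_measurable (borel \<Otimes>\<^sub>M borel)"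
  shows "diff_op is F \<in> borel_measurable (borel \<Otimes>\<^sub>M borel)"
  using assms by (induction "is") (auto simp: diff_op_Cons)

text \<open>Each operator for an index \<open>j\<close> reads the copy only at coordinate
  \<open>j\<close>.\<close>

lemma diff_op_local:
  assumes "i \<notin> set is"
  shows "diff_op is (\<lambda>(x, y). f x) (x, mix {i} y w) = diff_op is (\<lambda>(x, y). f x) (x, y)"
  using assms
proof (induction "is" arbitrary: x)
  case (Cons j js)
  then have "mix {j} x (mix {i} y w) = mix {j} x y"
    by (auto simp: vec_eq_iff)
  with Cons show ?case
    by (simp add: diff_op_Cons T_op_mix)
qed simp

context exchange_invariant
begin

abbreviation "pnorm \<equiv> partial_Linf_norm \<mu> (\<lambda>x. x)"

lemma pnorm_eq: "pnorm I F x = esssup \<mu>2 (\<lambda>z. ennreal \<bar>F (mix I x (fst z), snd z)\<bar>)"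
proof -
  have "distr \<mu> borel (\<lambda>x. x) = \<mu>"
    by (rule distr_id2) simp
  then show ?thesis
    by (simp add: partial_Linf_norm_def mix_def split_beta')
qed

section \<open>The partial essential supremum of a fixed measurable function\<close>

context
  fixes F :: "(real^'n) \<times> (real^'n) \<Rightarrow> real"
  assumes F [measurable]: "F \<in> borel_measurable (borel \<Otimes>\<^sub>M borel)"
begin

lemma AE_pnorm: "AE z in \<mu>2. ennreal \<bar>F (mix I x (fst z), snd z)\<bar> \<le> pnorm I F x"
  unfolding pnorm_eq by (rule esssup_AE)

lemma pnorm_le_iff: "pnorm I F x \<le> c \<longleftrightarrow> (AE z in \<mu>2. ennreal \<bar>F (mix I x (fst z), snd z)\<bar> \<le> c)"
proof
  assume "pnorm I F x \<le> c"
  with AE_pnorm[of I x] show "AE z in \<mu>2. ennreal \<bar>F (mix I x (fst z), snd z)\<bar> \<le> c"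
    by (auto elim: eventually_mono order_trans)
next
  assume "AE z in \<mu>2. ennreal \<bar>F (mix I x (fst z), snd z)\<bar> \<le> c"
  then show "pnorm I F x \<le> c"
    unfolding pnorm_eq by (rule esssup_I[rotated]) measurable
qed

text \<open>By \<open>pnorm_le_iff\<close> a sublevel set is where an almost everywhere statement
  with parameter \<open>x\<close> holds, so \<open>pred_AE\<close> applies.\<close>

lemma measurable_pnorm [measurable]: "pnorm I F \<in> borel_measurable borel"
proof (rule borel_measurableI_le)
  fix c
  have "Measurable.pred borel (\<lambda>x. pnorm I F x \<le> c)"
    unfolding pnorm_le_iff by (rule pred_AE[OF P.sigma_finite_measure_axioms]) measurable
  then show "{x \<in> space borel. pnorm I F x \<le> c} \<in> sets borel"
    by (simp add: pred_def)
qed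

lemma pnorm_mix: "S \<subseteq> I \<Longrightarrow> pnorm I F (mix S x y) = pnorm I F x"
proof -
  assume "S \<subseteq> I"
  then have "mix I (mix S x y) w = mix I x w" for w
    by (auto simp: vec_eq_iff)
  then show ?thesis
    by (simp add: pnorm_eq)
qed

text \<open>The norm evaluates \<open>F\<close> at mixed points. These have law
  \<open>\<mu>\<close>, so the null set where the bound fails stays null.\<close>

lemma AE_pnorm_le:
  assumes "AE z in \<mu>2. \<bar>F z\<bar> \<le> C"
  shows "AE x in \<mu>. pnorm I F x \<le> ennreal C"
proof -
  have [measurable]: "Measurable.pred borel (\<lambda>x. AE w in \<mu>. \<bar>F (x, w)\<bar> \<le> C)"
    by (rule pred_AE[OF sigma_finite_measure_axioms]) measurable
  have "AE x in \<mu>. AE w in \<mu>. \<bar>F (x, w)\<bar> \<le> C"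
    using P.AE_pair[OF assms] .
  then have "AE z in \<mu>2. AE w in \<mu>. \<bar>F (mix I (fst z) (snd z), w)\<bar> \<le> C"
    by (rule AE_mix[rotated]) measurable
  then have "AE x in \<mu>. AE y in \<mu>. AE w in \<mu>. \<bar>F (mix I x y, w)\<bar> \<le> C"
    using P.AE_pair by fastforce
  then show ?thesis
  proof eventually_elim
    case (elim x)
    have "AE z in \<mu>2. \<bar>F (mix I x (fst z), snd z)\<bar> \<le> C"
    proof (rule P.AE_pair_measure)
      show "{z \<in> space \<mu>2. \<bar>F (mix I x (fst z), snd z)\<bar> \<le> C} \<in> sets \<mu>2"
        by measurable
    qed (use elim in simp)
    then show ?case
      unfolding pnorm_le_iff by (auto elim!: eventually_mono intro: ennreal_leI)
  qed
qed

lemma pnorm_le_add: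
  assumes "AE w in \<mu>2. ennreal \<bar>F (mix I x (fst w), snd w) - F (mix I x' (fst w), snd w)\<bar> \<le> c"
  shows "pnorm I F x \<le> pnorm I F x' + c"
  unfolding pnorm_le_iff using AE_pnorm[of I x'] assms
proof eventually_elim
  case (elim w)
  have "ennreal \<bar>F (mix I x (fst w), snd w)\<bar> \<le>
      ennreal (\<bar>F (mix I x' (fst w), snd w)\<bar> + \<bar>F (mix I x (fst w), snd w) - F (mix I x' (fst w), snd w)\<bar>)"
    by (intro ennreal_leI) simp
  also have "\<dots> \<le> pnorm I F x' + c"
    using elim by (simp add: add_mono)
  finally show ?case .
qed

end

text \<open>Since \<open>F\<close> does not involve \<open>y\<^sub>i\<close>, an independent \<open>z\<^sub>i\<close> can replace it in the norm that bounds
  \<open>F - T\<^sub>i F\<close>; the other argument of that norm is matched by exchanging the \<open>i\<close>-th coordinates of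
  \<open>x\<close> and \<open>y\<close>.\<close>

lemma AE_diff_le_pnorm:
  assumes F [measurable]: "F \<in> borel_measurable (borel \<Otimes>\<^sub>M borel)"
    and i: "i \<notin> I" and F_local: "\<And>x y w. F (x, mix {i} y w) = F (x, y)"
  defines "N \<equiv> pnorm (insert i I) (\<lambda>z. F z - T_op i F z)"
  shows "AE z in \<mu>2. AE w in \<mu>2.
    ennreal \<bar>F (mix I (fst z) (fst w), snd w) - F (mix I (mix {i} (fst z) (snd z)) (fst w), snd w)\<bar> \<le> N (fst z)"
proof -
  let ?J = "insert i I"
  have D [measurable]: "(\<lambda>z. F z - T_op i F z) \<in> borel_measurable (borel \<Otimes>\<^sub>M borel)"
    by measurable
  have N [measurable]: "N \<in> borel_measurable borel"
    unfolding N_def by measurable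
  \<comment> \<open>Here \<open>y\<close> supplies the coordinates in \<open>?J\<close>,
    \<open>z\<close> the copy at \<open>i\<close>, and \<open>w\<close> the copy at the other
    coordinates.\<close>
  define V where "V x y z w \<longleftrightarrow>
    ennreal \<bar>F (mix ?J x y, w) - F (mix {i} (mix ?J x y) z, w)\<bar> \<le> N x" for x y z w
  have V1: "AE y in \<mu>. AE z in \<mu>. AE w in \<mu>. V x y z w" for x
  proof -
    have "AE z in \<mu>2. ennreal \<bar>F (mix ?J x (fst z), snd z) - T_op i F (mix ?J x (fst z), snd z)\<bar> \<le> N x"
      unfolding N_def by (rule AE_pnorm[OF D])
    then have "AE y in \<mu>. AE w in \<mu>. ennreal \<bar>F (mix ?J x y, w) - F (mix {i} (mix ?J x y) w, w)\<bar> \<le> N x"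
      by (auto simp: T_op_mix dest: P.AE_pair)
    then show ?thesis
    proof eventually_elim
      case (elim y)
      \<comment> \<open>Splits the copy in two: the vector with coordinate \<open>i\<close> from
        \<open>z\<close> and the others from \<open>w\<close> has law \<open>\<mu>\<close>, and
        \<open>F\<close> does not read its own copy argument at \<open>i\<close>.\<close>
      have "AE z in \<mu>2. ennreal \<bar>F (mix ?J x y, mix (- {i}) (fst z) (snd z)) -
          F (mix {i} (mix ?J x y) (mix (- {i}) (fst z) (snd z)), mix (- {i}) (fst z) (snd z))\<bar> \<le> N x"
        by (rule AE_mix[OF _ elim]) measurable
      moreover have "mix (- {i}) z w = mix {i} w z" "mix {i} u (mix {i} w z) = mix {i} u z" for z w u :: "real^'n"
        by (auto simp: vec_eq_iff)
      ultimately have "AE z in \<mu>2. V x y (fst z) (snd z)"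
        by (simp add: V_def F_local)
      then show ?case
        by (auto dest: P.AE_pair)
    qed
  qed
  have [measurable]: "Measurable.pred ((borel \<Otimes>\<^sub>M borel) \<Otimes>\<^sub>M borel) (\<lambda>(u, z). AE w in \<mu>. V (fst u) (snd u) z w)"
    unfolding split_beta' V_def by (rule pred_AE[OF sigma_finite_measure_axioms]) measurable
  have [measurable]: "Measurable.pred (borel \<Otimes>\<^sub>M borel) (\<lambda>u. AE z in \<mu>. AE w in \<mu>. V (fst u) (snd u) z w)"
    by (rule pred_AE[OF sigma_finite_measure_axioms]) measurable
  have "AE u in \<mu>2. AE z in \<mu>. AE w in \<mu>. V (fst u) (snd u) z w"
  proof (rule P.AE_pair_measure)
    show "{u \<in> space \<mu>2. AE z in \<mu>. AE w in \<mu>. V (fst u) (snd u) z w} \<in> sets \<mu>2"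
      by measurable
  qed (use V1 in simp)
  \<comment> \<open>Inside \<open>F\<close> the exchange puts coordinate \<open>i\<close> of
    \<open>x\<close> back in place, so \<open>mix ?J x y\<close> becomes \<open>mix I x y\<close>;
    \<open>N\<close> ignores coordinate \<open>i\<close> and keeps its value.\<close>
  from AE_exch[OF _ this, of "{i}"]
  have "AE u in \<mu>2. AE z in \<mu>. AE w in \<mu>. V (mix {i} (fst u) (snd u)) (mix {i} (snd u) (fst u)) z w"
    by (auto simp: exch_def split_beta')
  then have "AE x in \<mu>. AE y in \<mu>. AE z in \<mu>. AE w in \<mu>. V (mix {i} x y) (mix {i} y x) z w"
    using P.AE_pair by fastforce
  moreover define V' where "V' x z y w \<longleftrightarrow>
    ennreal \<bar>F (mix I x y, w) - F (mix I (mix {i} x z) y, w)\<bar> \<le> N x" for x z y w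
  have "V (mix {i} x y) (mix {i} y x) z w \<longleftrightarrow> V' x z y w" for x y z w
  proof -
    have "mix ?J (mix {i} x y) (mix {i} y x) = mix I x y" "mix {i} (mix I x y) z = mix I (mix {i} x z) y"
      using i by (auto simp: vec_eq_iff)
    moreover have "N (mix {i} x y) = N x"
      unfolding N_def by (rule pnorm_mix[OF D]) auto
    ultimately show ?thesis
      by (simp add: V_def V'_def)
  qed
  ultimately have AE': "AE x in \<mu>. AE y in \<mu>. AE z in \<mu>. AE w in \<mu>. V' x z y w"
    by simp
  have "AE x in \<mu>. AE z in \<mu>. AE v in \<mu>2. V' x z (fst v) (snd v)"
    using AE'
  proof eventually_elim
    case (elim x)
    have "Measurable.pred (borel \<Otimes>\<^sub>M borel) (\<lambda>u. AE w in \<mu>. V' x (snd u) (fst u) w)"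
      unfolding V'_def by (rule pred_AE[OF sigma_finite_measure_axioms]) measurable
    then have [measurable]: "Measurable.pred \<mu>2 (\<lambda>u. AE w in \<mu>. V' x (snd u) (fst u) w)"
      by measurable
    \<comment> \<open>The claim has the resampled point outside and the variables \<open>y\<close>,
      \<open>w\<close> of the norm inside, so \<open>z\<close> has to move in front of
      \<open>y\<close>.\<close>
    have "AE z in \<mu>. AE y in \<mu>. AE w in \<mu>. V' x z y w"
      using elim by (subst (asm) P.AE_commute) measurable
    then show ?case
    proof eventually_elim
      case (elim z)
      show ?case
      proof (rule P.AE_pair_measure)
        show "{v \<in> space \<mu>2. V' x z (fst v) (snd v)} \<in> sets \<mu>2"
          unfolding V'_def by measurable
      qed (use elim in simp)
    qed
  qed
  moreover have [measurable]: "Measurable.pred (borel \<Otimes>\<^sub>M borel) (\<lambda>u. AE v in \<mu>2. V' (fst u) (snd u) (fst v) (snd v))"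
    unfolding V'_def by (rule pred_AE[OF P.sigma_finite_measure_axioms]) measurable
  have "{u \<in> space \<mu>2. AE v in \<mu>2. V' (fst u) (snd u) (fst v) (snd v)} \<in> sets \<mu>2"
    by measurable
  ultimately have "AE u in \<mu>2. AE v in \<mu>2. V' (fst u) (snd u) (fst v) (snd v)"
    by (intro P.AE_pair_measure) auto
  then show ?thesis
    by (simp add: V'_def)
qed

end

section \<open>The hypermatrices of higher order differences\<close>

lemma h_entry_distr: "h_entry M X f is x = h_entry (distr M borel X) (\<lambda>x. x) f is x"
  by (simp add: h_entry_def h_diff_def partial_Linf_norm_def distr_id2)

text \<open>Arranges the hypermatrix of order k + 1 in rows by its first index; the norm of row
  \<open>i\<close> will bound the increment of \<open>hs k\<close> in coordinate
  \<open>i\<close>.\<close>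

lemma sum_lists_length_Suc:
  fixes \<phi> :: "'n::finite list \<Rightarrow> 'b::comm_monoid_add"
  shows "(\<Sum>is | length is = Suc k. \<phi> is) = (\<Sum>i\<in>UNIV. \<Sum>is | length is = k. \<phi> (i # is))"
proof -
  have "(\<Sum>i\<in>UNIV. \<Sum>is | length is = k. \<phi> (i # is)) = (\<Sum>(i, is)\<in>UNIV \<times> {is. length is = k}. \<phi> (i # is))"
    using finite_lists_length_eq[of "UNIV :: 'n set" k] by (subst sum.cartesian_product) auto
  also have "\<dots> = (\<Sum>is | length is = Suc k. \<phi> is)"
    by (rule sum.reindex_bij_witness[of _ "\<lambda>is. (hd is, tl is)" "\<lambda>(i, is). i # is"])
       (auto simp: length_Suc_conv)
  finally show ?thesis ..
qed

lemma L2_set_diff_le: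
  assumes "\<And>i. i \<in> A \<Longrightarrow> \<bar>u i - v i\<bar> \<le> w i"
  shows "\<bar>L2_set u A - L2_set v A\<bar> \<le> L2_set w A"
proof -
  have abs: "L2_set (\<lambda>i. \<bar>u i - v i\<bar>) A \<le> L2_set w A"
    using assms by (intro L2_set_mono) auto
  have 1: "L2_set (\<lambda>i. u i - v i) A = L2_set (\<lambda>i. \<bar>u i - v i\<bar>) A"
    "L2_set (\<lambda>i. v i - u i) A = L2_set (\<lambda>i. \<bar>u i - v i\<bar>) A"
    by (simp_all add: L2_set_def power2_commute)
  show ?thesis
    using L2_set_triangle_ineq[of v "\<lambda>i. u i - v i" A] L2_set_triangle_ineq[of u "\<lambda>i. v i - u i" A] abs
    by (simp add: 1)
qed

text \<open>Convexity at the midpoint. The 1/2 matters: it lets two equal terms add up to exactly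
  2^q times one of them in \<open>hs_moment_le\<close>.\<close>

lemma power_add_le_even:
  fixes a b :: real
  assumes "even q"
  shows "(a + b) ^ q \<le> 2 ^ q / 2 * (a ^ q + b ^ q)"
proof -
  have "((1 - 1 / 2) *\<^sub>R a + (1 / 2) *\<^sub>R b) ^ q \<le> (1 - 1 / 2) * a ^ q + 1 / 2 * b ^ q"
    by (rule convex_onD[OF convex_power_even[OF assms]]) auto
  then have "((a + b) / 2) ^ q \<le> (a ^ q + b ^ q) / 2"
    by (simp add: field_simps)
  then show ?thesis
    by (simp add: power_divide field_simps)
qed

lemma ennreal_half_power: "(1 :: ennreal) / 2 ^ n = ennreal (1 / 2 ^ n)"
  by (simp add: divide_ennreal[symmetric] ennreal_power[symmetric])

lemma ennreal_two_half_power: "(2 :: ennreal) * (1 / 2 ^ Suc n) = 1 / 2 ^ n"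
  using ennreal_mult[of 2 "1 / 2 ^ Suc n"] unfolding ennreal_half_power by simp

lemma bdd_fun_L2_set:
  assumes "\<And>i. i \<in> I \<Longrightarrow> bdd_fun (F i)"
  shows "bdd_fun (\<lambda>x. L2_set (\<lambda>i. F i x) I)"
proof -
  have "bdd_fun (\<lambda>x. \<Sum>i\<in>I. \<bar>F i x\<bar>)"
    using assms by (intro bdd_fun_sum) (auto simp: bdd_fun_def)
  then obtain C where C: "\<And>x. (\<Sum>i\<in>I. \<bar>F i x\<bar>) \<le> C"
    unfolding bdd_fun_def by (meson abs_le_D1)
  have "\<bar>L2_set (\<lambda>i. F i x) I\<bar> \<le> C" for x
    using order_trans[OF L2_set_le_sum_abs C] by simp
  then show ?thesis
    unfolding bdd_fun_def by blast
qed

lemma epowr_ennreal: "0 \<le> a \<Longrightarrow> epowr (ennreal a) p = ennreal (a powr p)"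
  by (simp add: epowr_def)

locale bounded_exchange_invariant = exchange_invariant \<mu> for \<mu> :: "(real^'n) measure" +
  fixes f :: "real^'n \<Rightarrow> real" and K :: real
  assumes f [measurable]: "f \<in> borel_measurable borel"
    and K_nonneg: "0 \<le> K"
    and AE_f_le: "AE x in \<mu>. \<bar>f x\<bar> \<le> K"
begin

abbreviation "H is x \<equiv> h_entry \<mu> (\<lambda>x. x) f is x"

text \<open>A version of the entry that is real and bounded at every point, as the moment inequality
  requires. The cut at \<open>K\<close> acts only on a null set, see \<open>AE_H_eq\<close>.\<close>

definition h :: "'n list \<Rightarrow> real^'n \<Rightarrow> real" where
  "h is x = enn2real (min (H is x) (ennreal K))"

definition hs :: "nat \<Rightarrow> real^'n \<Rightarrow> real" where
  "hs k x = L2_set (\<lambda>is. h is x) {is. length is = k}"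

lemma prob_UNIV [simp]: "prob UNIV = 1"
  using prob_space by simp

lemma measurable_H [measurable]: "(\<lambda>x. H is x) \<in> borel_measurable borel"
proof (cases "distinct is")
  case True
  have "(\<lambda>x. pnorm (set is) (diff_op is (\<lambda>(x, xb). f x)) x) \<in> borel_measurable borel"
    by measurable
  then show ?thesis
    using True by (simp add: h_entry_def h_diff_def)
qed (simp add: h_entry_def)

lemma measurable_h [measurable]: "h is \<in> borel_measurable borel"
  unfolding h_def by measurable

lemma h_nonneg: "0 \<le> h is x"
  by (simp add: h_def)

lemma h_le: "h is x \<le> K"
  unfolding h_def using K_nonneg
  by (metis enn2real_ennreal enn2real_mono ennreal_less_top min.cobounded2)

lemma bdd_fun_h: "bdd_fun (h is)"
  unfolding bdd_fun_def using h_nonneg h_le by (metis abs_of_nonneg)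

lemma h_mix: "i \<in> set is \<Longrightarrow> h is (mix {i} x y) = h is x"
proof -
  assume "i \<in> set is"
  then have "pnorm (set is) (diff_op is (\<lambda>(x, xb). f x)) (mix {i} x y) = pnorm (set is) (diff_op is (\<lambda>(x, xb). f x)) x"
    by (intro pnorm_mix) auto
  then show ?thesis
    by (simp add: h_def h_entry_def h_diff_def)
qed

text \<open>As \<open>i\<close> is not among the earlier indices, applying \<open>T_op i\<close>
  amounts to composing with the measure-preserving \<open>exch {i}\<close>, so each difference at
  most doubles the bound.\<close>

lemma AE_diff_op_le:
  "distinct is \<Longrightarrow> AE z in \<mu>2. \<bar>diff_op is (\<lambda>(x, xb). f x) z\<bar> \<le> 2 ^ length is * K"
proof (induction "is")
  case Nil
  have "AE z in \<mu>2. \<bar>f (fst z)\<bar> \<le> K"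
    by (rule AE_fst[OF _ AE_f_le]) measurable
  then show ?case
    by (simp add: split_beta')
next
  case (Cons i js)
  let ?F = "diff_op js (\<lambda>(x, xb). f x)"
  have F: "AE z in \<mu>2. \<bar>?F z\<bar> \<le> 2 ^ length js * K"
    using Cons by simp
  then have "AE z in \<mu>2. \<bar>?F (exch {i} z)\<bar> \<le> 2 ^ length js * K"
    by (rule AE_exch[rotated]) measurable
  with F show ?case
  proof eventually_elim
    case (elim z)
    have "T_op i ?F z = ?F (exch {i} z)"
      using Cons.prems by (cases z) (simp add: T_op_mix diff_op_local)
    with elim show ?case
      by (simp add: diff_op_Cons)
  qed
qed

lemma AE_H_eq: "AE x in \<mu>. H is x = ennreal (h is x)"
proof (cases "distinct is")
  case True
  let ?N = "pnorm (set is) (diff_op is (\<lambda>(x, xb). f x))"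
  have "AE x in \<mu>. ?N x \<le> ennreal (2 ^ length is * K)"
    by (rule AE_pnorm_le[OF _ AE_diff_op_le[OF True]]) measurable
  then show ?thesis
  proof eventually_elim
    case (elim x)
    have "H is x = 1 / 2 ^ length is * ?N x"
      using True by (simp add: h_entry_def h_diff_def)
    also have "\<dots> \<le> 1 / 2 ^ length is * ennreal (2 ^ length is * K)"
      by (intro mult_left_mono elim) auto
    also have "1 / 2 ^ length is = ennreal (1 / 2 ^ length is)"
      by (rule ennreal_half_power)
    also have "\<dots> * ennreal (2 ^ length is * K) = ennreal K"
      by (simp add: ennreal_mult[symmetric] K_nonneg)
    finally show ?case
      by (simp add: h_def min_absorb1 less_le_trans top.not_eq_extremum ennreal_enn2real_if)
         (metis ennreal_less_top leD top.not_eq_extremum)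
  qed
qed (simp add: h_entry_def h_def)

text \<open>If \<open>i\<close> occurs in \<open>is\<close>, or \<open>is\<close> has a repetition,
  the left side is 0. Otherwise \<open>AE_diff_le_pnorm\<close> bounds the change of the function
  inside the norm, and the triangle inequality passes to the norm. The 2 makes up for the additional
  1/2 in the normalisation of \<open>i # is\<close>.\<close>

lemma AE_h_exchange:
  "AE z in \<mu>2. \<bar>h is (fst z) - h is (mix {i} (fst z) (snd z))\<bar> \<le> 2 * h (i # is) (fst z)"
proof (cases "i \<in> set is \<or> \<not> distinct is")
  case True
  then have "h is (fst z) = h is (mix {i} (fst z) (snd z))" for z
    by (auto simp: h_mix) (simp add: h_def h_entry_def)
  then show ?thesis
    by (simp add: h_nonneg)
next
  case False
  let ?F = "diff_op is (\<lambda>(x, xb). f x)"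
  let ?N = "pnorm (set is) ?F" and ?N' = "pnorm (set (i # is)) (diff_op (i # is) (\<lambda>(x, xb). f x))"
  have H: "H is x = 1 / 2 ^ length is * ?N x" "2 * H (i # is) x = 1 / 2 ^ length is * ?N' x" for x
    using False by (simp_all add: h_entry_def h_diff_def ennreal_two_half_power mult.assoc[symmetric] del: power_Suc)
  have "AE z in \<mu>2. AE w in \<mu>2.
    ennreal \<bar>?F (mix (set is) (fst z) (fst w), snd w) - ?F (mix (set is) (mix {i} (fst z) (snd z)) (fst w), snd w)\<bar>
      \<le> ?N' (fst z)"
    using AE_diff_le_pnorm[of ?F i "set is"] False by (auto simp: diff_op_local diff_op_Cons)
  moreover have "AE z in \<mu>2. H is (fst z) = ennreal (h is (fst z))" "AE z in \<mu>2. H (i # is) (fst z) = ennreal (h (i # is) (fst z))"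
    by (rule AE_fst[OF _ AE_H_eq]; measurable)+
  moreover have "AE z in \<mu>2. H is (mix {i} (fst z) (snd z)) = ennreal (h is (mix {i} (fst z) (snd z)))"
    by (rule AE_mix[OF _ AE_H_eq]) measurable
  ultimately show ?thesis
  proof eventually_elim
    case (elim z)
    let ?x = "fst z" and ?y = "mix {i} (fst z) (snd z)"
    have "?N ?x \<le> ?N ?y + ?N' ?x"
      by (rule pnorm_le_add[OF _ elim(1)]) measurable
    then have "H is ?x \<le> H is ?y + 2 * H (i # is) ?x"
      unfolding H distrib_left[symmetric] by (rule mult_left_mono) simp
    moreover have "?N ?y \<le> ?N ?x + ?N' ?x"
      by (rule pnorm_le_add) (use elim(1) in \<open>auto simp: abs_minus_commute\<close>)
    then have "H is ?y \<le> H is ?x + 2 * H (i # is) ?x"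
      unfolding H distrib_left[symmetric] by (rule mult_left_mono) simp
    moreover have "2 * H (i # is) ?x = ennreal (2 * h (i # is) ?x)"
      unfolding elim by (simp add: ennreal_mult h_nonneg)
    ultimately show ?case
      unfolding elim using h_nonneg
      by (simp add: ennreal_plus[symmetric] ennreal_le_iff abs_le_iff del: ennreal_plus)
  qed
qed

text \<open>Not an instance of \<open>AE_h_exchange\<close>: the entry for the empty list is |f|,
  which forgets the sign.\<close>

lemma AE_f_exchange: "AE z in \<mu>2. \<bar>f (fst z) - f (mix {i} (fst z) (snd z))\<bar> \<le> 2 * h [i] (fst z)"
proof -
  let ?F = "\<lambda>(x :: real^'n, xb :: real^'n). f x"
  have "AE z in \<mu>2. AE w in \<mu>2.
    ennreal \<bar>?F (mix {} (fst z) (fst w), snd w) - ?F (mix {} (mix {i} (fst z) (snd z)) (fst w), snd w)\<bar>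
      \<le> pnorm (set [i]) (diff_op [i] ?F) (fst z)"
    using AE_diff_le_pnorm[of ?F i "{}"] by (auto simp: diff_op_Cons)
  then have "AE z in \<mu>2. ennreal \<bar>f (fst z) - f (mix {i} (fst z) (snd z))\<bar> \<le> pnorm (set [i]) (diff_op [i] ?F) (fst z)"
    by simp
  moreover have "AE z in \<mu>2. H [i] (fst z) = ennreal (h [i] (fst z))"
    by (rule AE_fst[OF _ AE_H_eq]) measurable
  ultimately show ?thesis
  proof eventually_elim
    case (elim z)
    have "(2 :: ennreal) * (1 / 2) = 1"
      using ennreal_two_half_power[of 0] by simp
    then have "2 * H [i] (fst z) = pnorm (set [i]) (diff_op [i] ?F) (fst z)"
      by (simp add: h_entry_def h_diff_def mult.assoc[symmetric])
    then have "ennreal \<bar>f (fst z) - f (mix {i} (fst z) (snd z))\<bar> \<le> ennreal (2 * h [i] (fst z))"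
      using elim by (simp add: ennreal_mult h_nonneg)
    then show ?case
      by (simp add: ennreal_le_iff h_nonneg)
  qed
qed

lemma hs_nonneg: "0 \<le> hs k x"
  by (simp add: hs_def)

lemma hs_power2: "(hs k x)\<^sup>2 = (\<Sum>is | length is = k. (h is x)\<^sup>2)"
  by (simp add: hs_def L2_set_def sum_nonneg)

lemma measurable_hs [measurable]: "hs k \<in> borel_measurable borel"
  unfolding hs_def L2_set_def by measurable

lemma bdd_fun_hs: "bdd_fun (hs k)"
  unfolding hs_def by (intro bdd_fun_L2_set bdd_fun_h)

lemma AE_hs_exchange:
  "AE z in \<mu>2. \<bar>hs k (fst z) - hs k (mix {i} (fst z) (snd z))\<bar> \<le>
    2 * L2_set (\<lambda>is. h (i # is) (fst z)) {is. length is = k}"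
proof -
  have "finite {is :: 'n list. length is = k}"
    using finite_lists_length_eq[of "UNIV :: 'n set" k] by simp
  then have "AE z in \<mu>2. \<forall>is\<in>{is. length is = k}.
      \<bar>h is (fst z) - h is (mix {i} (fst z) (snd z))\<bar> \<le> 2 * h (i # is) (fst z)"
    by (intro AE_finite_allI AE_h_exchange)
  then show ?thesis
  proof eventually_elim
    case (elim z)
    show ?case
      unfolding hs_def L2_set_right_distrib[OF zero_le_numeral]
      by (rule L2_set_diff_le) (use elim in auto)
  qed
qed

text \<open>Serves both the truncated \<open>f\<close> (with \<open>k = 0\<close>) and
  \<open>hs k\<close>. The norm of row \<open>i\<close> ignores coordinate \<open>i\<close> because
  \<open>i\<close> heads every list in it.\<close>

lemma moment_bound:
  fixes u :: "real^'n \<Rightarrow> real"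
  assumes [measurable]: "u \<in> borel_measurable borel" and bu: "bdd_fun u"
    and diff: "\<And>i. AE z in \<mu>2. \<bar>u (fst z) - u (mix {i} (fst z) (snd z))\<bar> \<le>
      2 * L2_set (\<lambda>is. h (i # is) (fst z)) {is. length is = k}"
  shows "(\<integral>x. (u x - (\<integral>y. u y \<partial>\<mu>)) ^ (2 * Suc n) \<partial>\<mu>) \<le>
    (4 * (2 * real n + 1)) ^ Suc n * (\<integral>x. hs (Suc k) x ^ (2 * Suc n) \<partial>\<mu>)"
proof -
  define v where "v x = u x - (\<integral>y. u y \<partial>\<mu>)" for x
  define L where "L i x = L2_set (\<lambda>is. h (i # is) x) {is. length is = k}" for i x
  have [measurable]: "v \<in> borel_measurable borel" "\<And>i. L i \<in> borel_measurable borel"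
    unfolding v_def L_def L2_set_def by measurable
  have dv: "AE z in \<mu>2. \<bar>v (fst z) - v (mix {i} (fst z) (snd z))\<bar> \<le> 2 * L i (fst z)" for i
    using diff by (simp add: v_def L_def)
  have L_mix: "L i (mix {i} x y) = L i x" and L_nonneg: "0 \<le> L i x" for i x y
    by (simp_all add: L_def h_mix)
  have "bdd_fun v"
    unfolding v_def by (intro bdd_intros bu)
  moreover have bL: "bdd_fun (L i)" for i
    unfolding L_def by (intro bdd_fun_L2_set bdd_fun_h)
  moreover have "(\<integral>x. v x \<partial>\<mu>) = 0"
    unfolding v_def using integrable_bdd_fun[OF bu] by (simp add: prob_space)
  ultimately have "(\<integral>x. v x ^ (2 * Suc n) \<partial>\<mu>) \<le>
      (4 * (2 * real n + 1)) ^ Suc n * (\<integral>x. (\<Sum>i\<in>UNIV. (L i x)\<^sup>2) ^ Suc n \<partial>\<mu>)"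
    using diff by (intro moment_bound_centered) (auto simp: dv L_mix L_nonneg)
  moreover have "(\<Sum>i\<in>UNIV. (L i x)\<^sup>2) = (hs (Suc k) x)\<^sup>2" for x
    by (simp add: hs_power2 sum_lists_length_Suc L_def L2_set_def sum_nonneg)
  ultimately show ?thesis
    by (simp only: v_def power_mult)
qed

lemma hs_moment_step:
  "(\<integral>x. hs k x ^ (2 * Suc n) \<partial>\<mu>) \<le> 2 ^ (2 * Suc n) / 2 * ((\<integral>x. hs k x \<partial>\<mu>) ^ (2 * Suc n) +
     (4 * (2 * real n + 1)) ^ Suc n * (\<integral>x. hs (Suc k) x ^ (2 * Suc n) \<partial>\<mu>))"
proof -
  define q where "q = 2 * Suc n"
  define m where "m = (\<integral>x. hs k x \<partial>\<mu>)"
  have int: "integrable \<mu> (\<lambda>x. hs k x ^ q)" "integrable \<mu> (\<lambda>x. (hs k x - m) ^ q)"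
    by (intro integrable_bdd_fun bdd_intros bdd_fun_hs; measurable)+
  have "(\<integral>x. hs k x ^ q \<partial>\<mu>) \<le> (\<integral>x. 2 ^ q / 2 * (m ^ q + (hs k x - m) ^ q) \<partial>\<mu>)"
    using power_add_le_even[of q m "hs k x - m" for x] int by (intro integral_mono) (auto simp: q_def)
  also have "\<dots> = 2 ^ q / 2 * (m ^ q + (\<integral>x. (hs k x - m) ^ q \<partial>\<mu>))"
    using int by (simp add: prob_space)
  also have "\<dots> \<le> 2 ^ q / 2 * (m ^ q + (4 * (2 * real n + 1)) ^ Suc n * (\<integral>x. hs (Suc k) x ^ q \<partial>\<mu>))"
    unfolding q_def m_def
    by (intro mult_left_mono add_left_mono moment_bound AE_hs_exchange bdd_fun_hs) auto
  finally show ?thesis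
    by (simp only: q_def m_def)
qed

text \<open>Jensen's inequality, in the form that a variance is nonnegative.\<close>

lemma mean_hs_le:
  assumes "(\<integral>x. (hs k x)\<^sup>2 \<partial>\<mu>) \<le> a\<^sup>2" "0 \<le> a"
  shows "(\<integral>x. hs k x \<partial>\<mu>) \<le> a"
proof -
  have int: "integrable \<mu> (hs k)" "integrable \<mu> (\<lambda>x. (hs k x)\<^sup>2)"
    by (intro integrable_bdd_fun bdd_intros bdd_fun_hs; measurable)+
  have "0 \<le> variance (hs k)"
    by (rule variance_positive)
  then have "(\<integral>x. hs k x \<partial>\<mu>)\<^sup>2 \<le> a\<^sup>2"
    using assms by (simp add: variance_eq[OF int])
  then show ?thesis
    using assms(2) by (rule power2_le_imp_le)
qed

section \<open>Descent from order \<open>d\<close> to order 1 and to \<open>f\<close>\<close>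

context
  fixes t r :: real and n d :: nat
  assumes t: "0 \<le> t" and r: "0 \<le> r" and rn: "16 * (2 * real n + 1) * r\<^sup>2 \<le> 1"
    and L2: "\<And>k. 1 \<le> k \<Longrightarrow> k < d \<Longrightarrow> (\<integral>x. (hs k x)\<^sup>2 \<partial>\<mu>) \<le> (t * r ^ k)\<^sup>2"
    and Linf: "AE x in \<mu>. hs d x \<le> t * r ^ d"
begin

text \<open>Downward induction. At \<open>d\<close> the almost sure bound controls every moment;
  below \<open>d\<close> only second moments are given, and they are used just for the mean, while
  the fluctuation is left to order k + 1.\<close>

lemma hs_moment_le:
  assumes "1 \<le> k" "k \<le> d"
  shows "(\<integral>x. hs k x ^ (2 * Suc n) \<partial>\<mu>) \<le> (2 * t * r ^ k) ^ (2 * Suc n)"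
  using assms(2,1)
proof (induction k rule: inc_induct)
  case base
  have "(\<integral>x. hs d x ^ (2 * Suc n) \<partial>\<mu>) \<le> (\<integral>x. (t * r ^ d) ^ (2 * Suc n) \<partial>\<mu>)"
  proof (rule integral_mono_AE)
    show "integrable \<mu> (\<lambda>x. hs d x ^ (2 * Suc n))"
      by (intro integrable_bdd_fun bdd_intros bdd_fun_hs; measurable)
    show "AE x in \<mu>. hs d x ^ (2 * Suc n) \<le> (t * r ^ d) ^ (2 * Suc n)"
      using Linf by eventually_elim (intro power_mono hs_nonneg)
  qed simp
  also have "\<dots> \<le> (2 * t * r ^ d) ^ (2 * Suc n)"
    using t r by (simp del: power_Suc mult_Suc_right)
  finally show ?case .
next
  case (step k)
  let ?q = "2 * Suc n" and ?A = "4 * (2 * real n + 1)"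
  have "?A ^ Suc n * (2 * t * r ^ Suc k) ^ ?q = (16 * (2 * real n + 1) * r\<^sup>2) ^ Suc n * (t * r ^ k) ^ ?q"
    unfolding power_mult power_mult_distrib[symmetric] by (simp add: power2_eq_square algebra_simps)
  also have "\<dots> \<le> 1 * (t * r ^ k) ^ ?q"
    using rn r t by (intro mult_right_mono power_le_one) auto
  finally have *: "?A ^ Suc n * (2 * t * r ^ Suc k) ^ ?q \<le> (t * r ^ k) ^ ?q"
    by simp
  have "(\<integral>x. hs k x ^ ?q \<partial>\<mu>) \<le> 2 ^ ?q / 2 * ((\<integral>x. hs k x \<partial>\<mu>) ^ ?q + ?A ^ Suc n * (\<integral>x. hs (Suc k) x ^ ?q \<partial>\<mu>))"
    by (rule hs_moment_step)
  also have "\<dots> \<le> 2 ^ ?q / 2 * ((t * r ^ k) ^ ?q + ?A ^ Suc n * (2 * t * r ^ Suc k) ^ ?q)"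
    using step t r by (intro mult_left_mono add_mono power_mono mean_hs_le L2) (auto intro: Bochner_Integration.integral_nonneg hs_nonneg)
  also have "\<dots> \<le> 2 ^ ?q / 2 * ((t * r ^ k) ^ ?q + (t * r ^ k) ^ ?q)"
    by (intro mult_left_mono add_left_mono *) auto
  also have "\<dots> = (2 * t * r ^ k) ^ ?q"
    by (simp add: power_mult_distrib del: power_Suc mult_Suc_right)
  finally show ?case .
qed

text \<open>As \<open>f\<close> has mean zero, no convexity factor is paid at this last level.
  Truncation at \<open>K\<close> makes \<open>f\<close> bounded everywhere, alters it on a null set
  only, and does not enlarge increments.\<close>

lemma f_moment_le:
  assumes "1 \<le> d" and mean: "(\<integral>x. f x \<partial>\<mu>) = 0"
  shows "(\<integral>x. f x ^ (2 * Suc n) \<partial>\<mu>) \<le> (16 * (2 * real n + 1) * r\<^sup>2) ^ Suc n * t ^ (2 * Suc n)"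
proof -
  define u where "u x = max (- K) (min K (f x))" for x
  have [measurable]: "u \<in> borel_measurable borel"
    unfolding u_def by measurable
  have bu: "bdd_fun u"
    unfolding bdd_fun_def using K_nonneg by (intro exI[of _ K]) (auto simp: u_def)
  have fu: "AE x in \<mu>. f x = u x"
    using AE_f_le by eventually_elim (auto simp: u_def)
  have "AE z in \<mu>2. \<bar>u (fst z) - u (mix {i} (fst z) (snd z))\<bar> \<le>
      2 * L2_set (\<lambda>is. h (i # is) (fst z)) {is. length is = 0}" for i
  proof -
    have "\<bar>u x - u y\<bar> \<le> \<bar>f x - f y\<bar>" for x y
      by (auto simp: u_def)
    then show ?thesis
      using AE_f_exchange[of i] by (auto elim!: eventually_mono intro: order_trans simp: h_nonneg)
  qed
  then have "(\<integral>x. (u x - (\<integral>y. u y \<partial>\<mu>)) ^ (2 * Suc n) \<partial>\<mu>) \<le>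
      (4 * (2 * real n + 1)) ^ Suc n * (\<integral>x. hs (Suc 0) x ^ (2 * Suc n) \<partial>\<mu>)"
    using bu by (intro moment_bound) auto
  also have "(\<integral>y. u y \<partial>\<mu>) = 0"
    using integral_cong_AE[OF _ _ fu] mean by simp
  also have "(\<integral>x. (u x - 0) ^ (2 * Suc n) \<partial>\<mu>) = (\<integral>x. f x ^ (2 * Suc n) \<partial>\<mu>)"
    using fu by (intro integral_cong_AE) (auto simp del: power_Suc mult_Suc_right elim!: eventually_mono)
  also have "(4 * (2 * real n + 1)) ^ Suc n * (\<integral>x. hs (Suc 0) x ^ (2 * Suc n) \<partial>\<mu>) \<le>
      (4 * (2 * real n + 1)) ^ Suc n * (2 * t * r ^ 1) ^ (2 * Suc n)"
    using hs_moment_le[of 1] assms(1) by (intro mult_left_mono) auto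
  also have "\<dots> = (16 * (2 * real n + 1) * r\<^sup>2) ^ Suc n * t ^ (2 * Suc n)"
    unfolding power_mult power_mult_distrib[symmetric] by (simp add: power2_eq_square algebra_simps)
  finally show ?thesis .
qed

lemma tail_le:
  assumes "1 \<le> d" "(\<integral>x. f x \<partial>\<mu>) = 0" "0 < t" "16 * (2 * real n + 1) * r\<^sup>2 \<le> exp (- 2)"
  shows "prob {x. t \<le> \<bar>f x\<bar>} \<le> exp (- (2 * real n + 2))"
proof -
  define q where "q = 2 * Suc n"
  have q [simp]: "even q" "0 < q"
    by (auto simp: q_def)
  have "integrable \<mu> (\<lambda>x. f x ^ q)"
    using AE_f_le
    by (intro integrable_const_bound[where B = "K ^ q"])
       (auto elim!: eventually_mono simp: power_abs power_mono)
  then have "prob {x \<in> space \<mu>. t ^ q \<le> f x ^ q} \<le> (\<integral>x. f x ^ q \<partial>\<mu>) / t ^ q"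
    using \<open>0 < t\<close> by (intro integral_Markov_inequality_measure[where A = "{}"]) (auto simp: zero_le_even_power)
  also have "\<dots> \<le> (16 * (2 * real n + 1) * r\<^sup>2) ^ Suc n"
    using f_moment_le[OF assms(1,2)] \<open>0 < t\<close> by (simp only: pos_divide_le_eq zero_less_power q_def)
  also have "\<dots> \<le> exp (- 2) ^ Suc n"
    using assms(4) by (intro power_mono) auto
  also have "\<dots> = exp (- (2 * real n + 2))"
    by (simp add: exp_of_nat_mult[symmetric] algebra_simps del: power_Suc)
  also have "{x \<in> space \<mu>. t ^ q \<le> f x ^ q} = {x. t \<le> \<bar>f x\<bar>}"
    using \<open>0 < t\<close> using power_mono_iff[of t "\<bar>f x\<bar>" q for x] by (auto simp: power_even_abs)
  finally show ?thesis .
qed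

end

lemma AE_h_HS: "AE x in \<mu>. h_HS \<mu> (\<lambda>x. x) f k x = ennreal (hs k x)"
proof -
  have "finite {is :: 'n list. length is = k}"
    using finite_lists_length_eq[of "UNIV :: 'n set" k] by simp
  then have "AE x in \<mu>. \<forall>is\<in>{is. length is = k}. H is x = ennreal (h is x)"
    by (intro AE_finite_allI AE_H_eq)
  then show ?thesis
  proof eventually_elim
    case (elim x)
    then have "(\<Sum>is | length is = k. (H is x)\<^sup>2) = (\<Sum>is | length is = k. ennreal ((h is x)\<^sup>2))"
      by (intro sum.cong) (auto simp: ennreal_power h_nonneg)
    also have "\<dots> = ennreal ((hs k x)\<^sup>2)"
      by (simp add: hs_power2)
    finally show ?case
      by (simp add: h_HS_def epowr_ennreal powr_half_sqrt hs_nonneg)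
  qed
qed

end

section \<open>From \<open>eta\<close> to bounds on the norms\<close>

lemma h_HS_distr: "h_HS M X f k x = h_HS (distr M borel X) (\<lambda>x. x) f k x"
  by (simp add: h_HS_def h_entry_distr[of M X])

text \<open>Solves one term of \<open>eta\<close> for the norm. Since \<open>R\<close> is positive,
  neither \<open>t = 0\<close> nor an infinite norm is possible, as either makes the quotient
  0.\<close>

lemma quotient_boundD:
  assumes "0 \<le> t" "0 < R" "0 < k"
    and R: "ennreal R \<le> epowr (ennreal t) (2 / real k) / epowr N (2 / real k)"
  shows "0 < t" "N \<le> ennreal (t * (1 / sqrt R) ^ k)"
proof -
  let ?s = "2 / real k"
  show "0 < t"
  proof (rule ccontr)
    assume "\<not> 0 < t"
    with assms have "epowr (ennreal t) ?s = 0"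
      by (simp add: epowr_def)
    with R \<open>0 < R\<close> show False
      by simp
  qed
  show "N \<le> ennreal (t * (1 / sqrt R) ^ k)"
  proof (cases N)
    case (real b)
    show ?thesis
    proof (cases "b = 0")
      case False
      with real have "0 < b"
        by simp
      then have "epowr (ennreal t) ?s / epowr N ?s = ennreal ((t / b) powr ?s)"
        using real \<open>0 < t\<close> by (simp add: epowr_ennreal divide_ennreal powr_divide)
      with R have "R \<le> (t / b) powr ?s"
        using \<open>0 < R\<close> by (simp add: ennreal_le_iff)
      then have "R powr (real k / 2) \<le> ((t / b) powr ?s) powr (real k / 2)"
        using \<open>0 < R\<close> by (intro powr_mono2) auto
      also have "\<dots> = t / b"
        using \<open>0 < t\<close> \<open>0 < b\<close> \<open>0 < k\<close> by (simp add: powr_powr)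
      also have "R powr (real k / 2) = (R powr (1 / 2)) powr real k"
        by (simp add: powr_powr)
      also have "\<dots> = sqrt R ^ k"
        using \<open>0 < R\<close> by (simp add: powr_half_sqrt powr_realpow)
      finally have "b \<le> t * (1 / sqrt R) ^ k"
        using \<open>0 < b\<close> \<open>0 < R\<close> by (simp add: field_simps power_divide)
      with real show ?thesis
        by (simp add: ennreal_leI)
    qed (use real in simp)
  next
    case top
    with R \<open>0 < R\<close> show ?thesis
      by (simp add: epowr_def)
  qed
qed

section \<open>The tail bound\<close>

theorem corollary1p4:
  fixes M :: "'a measure"
    and X :: "'a \<Rightarrow> real^'n"
    and f :: "real^'n \<Rightarrow> real"
    and d :: nat and t :: real
  assumes "prob_space M"
    and "X \<in> borel_measurable M"
    and "prob_space.indep_vars M (\<lambda>_. borel) (\<lambda>i \<omega>. X \<omega> $ i) UNIV"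
    and "d \<in> {1..CARD('n)}"
    and "f \<in> borel_measurable borel"
    and "esssup M (\<lambda>\<omega>. ennreal \<bar>f (X \<omega>)\<bar>) < \<infinity>"
    and "prob_space.expectation M (\<lambda>\<omega>. f (X \<omega>)) = 0"
    and "t \<ge> 0"
  shows "measure M {\<omega> \<in> space M. \<bar>f (X \<omega>)\<bar> \<ge> t}
           \<le> (exp 1)\<^sup>2 * exp_minus (eta M X f d t / ennreal (41 * (real d * exp 1)\<^sup>2))"
proof -
  interpret M: prob_space M by fact
  note f [measurable] = assms(5)
  define \<mu> where "\<mu> = distr M borel X"
  define K where "K = enn2real (esssup M (\<lambda>\<omega>. ennreal \<bar>f (X \<omega>)\<bar>))"
  have X' [measurable]: "X \<in> M \<rightarrow>\<^sub>M borel"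
    by fact
  interpret exchange_invariant \<mu>
    unfolding \<mu>_def by (rule exchange_invariantI) fact+
  have AE_\<mu>: "(AE x in \<mu>. Q x) \<longleftrightarrow> (AE \<omega> in M. Q (X \<omega>))" if [measurable]: "Measurable.pred borel Q" for Q
    unfolding \<mu>_def by (rule AE_distr_iff) measurable
  have "AE \<omega> in M. \<bar>f (X \<omega>)\<bar> \<le> K"
    using esssup_AE[where M = M and f = "\<lambda>\<omega>. ennreal \<bar>f (X \<omega>)\<bar>"]
  proof eventually_elim
    case (elim \<omega>)
    then show ?case
      using assms(6) enn2real_mono[OF elim] by (simp add: K_def less_top)
  qed
  then have "AE x in \<mu>. \<bar>f x\<bar> \<le> K"
    by (subst AE_\<mu>) measurable
  then interpret bounded_exchange_invariant \<mu> f K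
    by unfold_locales (auto simp: K_def)
  have mean: "(\<integral>x. f x \<partial>\<mu>) = 0"
    unfolding \<mu>_def using assms(7) by (subst integral_distr) measurable
  have prob_eq: "measure M {\<omega> \<in> space M. \<bar>f (X \<omega>)\<bar> \<ge> t} = prob {x. t \<le> \<bar>f x\<bar>}"
    unfolding \<mu>_def by (subst measure_distr) (auto intro!: arg_cong[where f = M.prob])
  have AE_HS: "AE \<omega> in M. h_HS M X f k (X \<omega>) = ennreal (hs k (X \<omega>))" for k
    unfolding h_HS_distr[of M X] \<mu>_def[symmetric]
    using AE_distrD[OF X'] AE_h_HS[of k] \<mu>_def by blast
  have HS_2: "h_HS_norm M X f k 2 = ennreal (sqrt (\<integral>x. (hs k x)\<^sup>2 \<partial>\<mu>))" for k
  proof -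
    have "(\<integral>\<^sup>+ \<omega>. epowr (h_HS M X f k (X \<omega>)) 2 \<partial>M) = (\<integral>\<^sup>+ \<omega>. ennreal ((hs k (X \<omega>))\<^sup>2) \<partial>M)"
      using AE_HS[of k]
      by (intro nn_integral_cong_AE) (auto elim!: eventually_mono simp: epowr_ennreal hs_nonneg)
    also have "\<dots> = (\<integral>\<^sup>+ x. ennreal ((hs k x)\<^sup>2) \<partial>\<mu>)"
    proof -
      have "(\<integral>\<^sup>+ x. g x \<partial>\<mu>) = (\<integral>\<^sup>+ \<omega>. g (X \<omega>) \<partial>M)" if "g \<in> borel_measurable borel" for g
        unfolding \<mu>_def using that by (intro nn_integral_distr) auto
      then show ?thesis
        by simp
    qed
    also have "\<dots> = ennreal (\<integral>x. (hs k x)\<^sup>2 \<partial>\<mu>)"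
      by (intro nn_integral_eq_integral integrable_bdd_fun bdd_intros bdd_fun_hs) simp_all
    finally show ?thesis
      by (simp add: h_HS_norm_def epowr_ennreal powr_half_sqrt)
  qed
  define c where "c = 41 * (real d * exp 1)\<^sup>2"
  have d: "1 \<le> d" and c: "0 < c"
    using assms(4) by (auto simp: c_def)
  \<comment> \<open>Stated for every positive real \<open>p\<close> up to the quotient, so that an
    infinite \<open>eta\<close> is covered by letting \<open>p\<close> tend to infinity.\<close>
  have key: "prob {x. t \<le> \<bar>f x\<bar>} \<le> exp (2 - p)" if p: "0 < p" "ennreal (c * p) \<le> eta M X f d t" for p
  proof (cases "p < 2")
    case True
    have "prob {x. t \<le> \<bar>f x\<bar>} \<le> 1"
      by simp
    also have "\<dots> \<le> exp (2 - p)"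
      using True by simp
    finally show ?thesis .
  next
    case False
    define R where "R = c * p"
    define r where "r = 1 / sqrt R"
    \<comment> \<open>This makes \<open>2 * n + 2\<close> the largest even integer not above
      \<open>p\<close>; as \<open>p\<close> is at least 2, the subtraction on naturals is
      exact.\<close>
    define n where "n = nat \<lfloor>p / 2\<rfloor> - 1"
    have R: "0 < R"
      using c p by (simp add: R_def)
    have n: "2 * real n + 2 \<le> p" "p < 2 * real n + 4"
      using False unfolding n_def by linarith+
    have "ennreal R \<le> epowr (ennreal t) (2 / real d) / epowr (h_HS_norm M X f d \<infinity>) (2 / real d)"
      and k: "\<And>k. k \<in> {1..d - 1} \<Longrightarrow> ennreal R \<le> epowr (ennreal t) (2 / real k) / epowr (h_HS_norm M X f k 2) (2 / real k)"
      using p(2) by (auto simp: eta_def R_def le_INF_iff)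
    note dd = quotient_boundD[OF assms(8) R _ this(1)]
    have t: "0 < t"
      using dd(1) d by simp
    have "AE \<omega> in M. hs d (X \<omega>) \<le> t * r ^ d"
      using esssup_AE[where M = M and f = "\<lambda>\<omega>. h_HS M X f d (X \<omega>)"] AE_HS[of d]
    proof eventually_elim
      case (elim \<omega>)
      have "ennreal (hs d (X \<omega>)) \<le> h_HS_norm M X f d \<infinity>"
        using elim by (simp add: h_HS_norm_def)
      also have "\<dots> \<le> ennreal (t * r ^ d)"
        using dd(2) d by (simp add: r_def)
      finally show ?case
        using t R by (simp add: ennreal_le_iff r_def)
    qed
    then have Linf: "AE x in \<mu>. hs d x \<le> t * r ^ d"
      by (subst AE_\<mu>) measurable
    have L2: "(\<integral>x. (hs k x)\<^sup>2 \<partial>\<mu>) \<le> (t * r ^ k)\<^sup>2" if "1 \<le> k" "k < d" for k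
    proof -
      have "k \<in> {1..d - 1}"
        using that by auto
      from quotient_boundD(2)[OF assms(8) R _ k[OF this]] that
      have "sqrt (\<integral>x. (hs k x)\<^sup>2 \<partial>\<mu>) \<le> t * r ^ k"
        using t R by (simp add: HS_2 ennreal_le_iff r_def)
      then show ?thesis
        using t R by (simp add: real_sqrt_le_iff sqrt_le_D)
    qed
    have "16 * (2 * real n + 1) * r\<^sup>2 \<le> 16 * p / R"
      using n R by (simp add: r_def power_divide divide_right_mono)
    \<comment> \<open>\<open>p\<close> cancels against \<open>R = c * p\<close>, and the e^2 inside
      \<open>c\<close> supplies the \<open>exp (- 2)\<close> that \<open>tail_le\<close> asks
      for.\<close>
    also have "\<dots> = 16 / 41 / (real d)\<^sup>2 * exp (- 2)"
      using p(1) d by (simp add: R_def c_def power_mult_distrib exp_minus field_simps flip: exp_double)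
    also have "\<dots> \<le> 1 * exp (- 2)"
    proof (rule mult_right_mono)
      have "1 \<le> (real d)\<^sup>2"
        using d by simp
      then have "16 \<le> 41 * (real d)\<^sup>2"
        by linarith
      then show "16 / 41 / (real d)\<^sup>2 \<le> 1"
        using d by (simp add: divide_le_eq)
    qed simp
    finally have rn: "16 * (2 * real n + 1) * r\<^sup>2 \<le> exp (- 2)"
      by simp
    then have "16 * (2 * real n + 1) * r\<^sup>2 \<le> 1"
      by (rule order_trans) simp
    moreover have "0 \<le> r"
      using R by (simp add: r_def)
    ultimately have "prob {x. t \<le> \<bar>f x\<bar>} \<le> exp (- (2 * real n + 2))"
      using t by (intro tail_le[OF _ _ _ L2 Linf d mean t rn]) auto
    also have "\<dots> \<le> exp (2 - p)"
      using n by simp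
    finally show ?thesis .
  qed
  define y where "y = eta M X f d t / ennreal c"
  have "prob {x. t \<le> \<bar>f x\<bar>} \<le> (exp 1)\<^sup>2 * exp_minus y"
  proof (cases y)
    case (real p)
    show ?thesis
    proof (cases "p = 0")
      case True
      have "prob {x. t \<le> \<bar>f x\<bar>} \<le> 1"
        by simp
      also have "\<dots> \<le> (exp 1)\<^sup>2 * exp_minus y"
        using real True by (simp add: exp_minus_def one_le_power)
      finally show ?thesis .
    next
      case False
      have "eta M X f d t = ennreal (c * p)"
      proof (cases "eta M X f d t")
        case (real e)
        then show ?thesis
          using \<open>y = ennreal p\<close> \<open>0 \<le> p\<close> c by (auto simp: y_def divide_ennreal field_simps)
      next
        case top
        then show ?thesis
          using \<open>y = ennreal p\<close> by (simp add: y_def ennreal_top_divide)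
      qed
      then have "prob {x. t \<le> \<bar>f x\<bar>} \<le> exp (2 - p)"
        using real False by (intro key) auto
      also have "\<dots> = (exp 1)\<^sup>2 * exp_minus y"
        using real by (simp add: exp_minus_def exp_diff exp_minus field_simps flip: exp_double)
      finally show ?thesis .
    qed
  next
    case top
    have eta: "eta M X f d t = \<infinity>"
    proof (rule ccontr)
      assume "eta M X f d t \<noteq> \<infinity>"
      then show False
        using top c by (cases "eta M X f d t") (auto simp: y_def divide_ennreal)
    qed
    have "prob {x. t \<le> \<bar>f x\<bar>} \<le> 0"
    proof (rule tendsto_lowerbound)
      show "((\<lambda>p. exp (2 - p)) \<longlongrightarrow> (0 :: real)) at_top"
        by real_asymp
      show "\<forall>\<^sub>F p in at_top. prob {x. t \<le> \<bar>f x\<bar>} \<le> exp (2 - p)"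
        using eventually_gt_at_top[of 0] by eventually_elim (simp add: key eta)
    qed simp
    with top show ?thesis
      by (simp add: exp_minus_def)
  qed
  then show ?thesis
    unfolding prob_eq y_def c_def .
qed

end
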